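(* Let $\mathcal H$ be a real Hilbert space and let $U_i\colon\mathcal{H}\to\mathcal{H}$ be a cutter for each $i\in I:=\{1,\ldots,M\}$, such that $C:=\bigcap_{i\in I} \operatorname{Fix} U_i \neq \emptyset$. Let the sequence $\{x^k\}_{k=0}^{\infty}$ be defined by $$x^0\in\mathcal{H} \qquad \text{and} \qquad x^{k+1} := x^k+\lambda_k \sigma_k(x^k)\left(T_k x^{k}-x^k\right),\quad k=0,1,2,\ldots,$$ where $T_k:=\sum_{n=1}^{N_k} \omega_n^k Q_n^k$, $Q_n^k:=\prod_{j\in J_n^k} U_j$ is the product of operators along the string $J_n^k\subseteq I$, the weights $\omega_n^k>0$ satisfy $\sum_{n=1}^{N_k}\omega_n^{k}=1$, $\lambda_k>0$ and $\sigma_k\colon\mathcal H \to [1,\infty)$. Let $I_k := \bigcup_{n=1}^{N_k} J_n^k$, $m_n^k:=|J_n^k|$, $m_k:=\max_{1\leq n\leq N_k} m_n^k$, let $Q_{n,l}^k$ be the product of the first $l$ operators along the string $J_n^k$, with $Q_{n,0}^k:=\operatorname{Id}$, and assume $m:=\sup_k m_k<\infty$. Assume that $\omega_n^k\in[\omega,1]$ for some $\omega \in (0,1]$, that $\lambda_k \in[\underline \lambda, \overline \lambda]$ for some $\underline{\lambda} \in (0,1]$ and $\overline \lambda \in [1,1+\frac 1 m)$, and that $\sigma_k(x)\in [1,\tau_k(x)]$ for each $x\in \mathcal H$, where $$\tau_k(x):=\frac{\frac{m_k}{m_k+1}\sum_{n=1}^{N_k} \omega_n^k\left(\left\|Q_n^kx-x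 \right\|^2+ \sum_{l=1}^{m_n^k}\|Q_{n,l}^kx-Q_{n,l-1}^{k}x\|^2 \right)}{\left\|T_k x-x\right\|^{2}}\quad\text{if } x\notin \bigcap_{i\in I_k}\operatorname{Fix} U_i,$$ and $\tau_k(x):=1$ otherwise. Moreover, assume that the control $\{I_k\}_{k=0}^\infty$ is $s$-intermittent, that is, there is an integer $s\geq 1$ such that $I = I_k\cup\ldots\cup I_{k+s-1}$ for each $k=0,1,2,\ldots$. Set $r:=d(x^0,C)$ and $B:=B(P_Cx^0, r)$. Then the following statements are true: (i) If each $U_i$ is weakly regular over $B$, then $\{x^k\}_{k=0}^{\infty}$ converges weakly to some point $x^\infty\in C \cap B$. (ii) If each $U_i$ is regular over $B$ and the family $\{\operatorname{Fix} U_i \mid i\in I\}$ is regular over $B$, then the convergence to $x^\infty$ (a point of $C\cap B$) is in norm. (iii) If each $U_i$ is $\delta_i$-linearly regular over $B$ and the family $\{\operatorname{Fix} U_i\mid i\in I\}$ is $\kappa$-linearly regular over $B$, then, with $x^\infty\in C\cap B$ the limit of $\{x^k\}_{k=0}^\infty$, for all $k=0,1,2,\ldots$ we have $$\frac{\delta}{2\kappa}\|x^k-x^\infty\|\leq \max_{i\in I}\|U_ix^k-x^k\|\leq \|x^k-x^\infty\|$$ and $$\|x^k-x^\infty\|\leq 2d(x^0,C)\left(\sqrt[2s]{1-\frac{\omega\rho\delta^2}{s\kappa^2 }\min \left\{ \frac 1 {\omega\delta^2},\ \inf_k \Theta_{k} \right\}}\right)^{k-s+1},$$ where $\delta := \min_{i\in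 I}\delta_i$, $\rho:=\frac 1 {m\overline{\lambda }} + \frac{1-\overline{\lambda}}{\overline{\lambda }}$ and $$\Theta_k:=\lambda_k\sigma_k(x^k)\frac{1+m_k-m_k\lambda_k\frac{\sigma_k(x^k)}{\tau_k(x^k)}}{1+m_k-\frac{m_k}{\tau_k(x^k)}}.$$ In particular, the convergence to $x^\infty$ is $R$-linear.
   Context: $\mathcal H$ is a real Hilbert space; $\operatorname{Fix} U$ is the fixed point set of $U$; $P_C$ is the metric projection onto a nonempty closed convex set $C$; $d(x,C)=\inf_{z\in C}\|x-z\|$; $B(z,r)$ is the closed ball with center $z$ and radius $r$. An operator $U\colon\mathcal H\to\mathcal H$ with $\operatorname{Fix}U\ne\emptyset$ is a cutter if $\langle z-Ux,x-Ux\rangle\le 0$ for all $x\in\mathcal H$ and $z\in\operatorname{Fix}U$ (its fixed point set is then closed and convex). A string is a nonempty ordered subset $J=(i_1,\ldots,i_p)$ of $I$; the product along it is $\prod_{j\in J}U_j:=U_{i_p}\cdots U_{i_1}$ (so $U_{i_1}$ is applied first), and the product of its first $l$ operators is $U_{i_l}\cdots U_{i_1}$. Let $S\subseteq\mathcal H$ be nonempty and let $U\colon\mathcal H\to\mathcal H$ have a fixed point. $U$ is weakly regular over $S$ if for every sequence $\{x^k\}\subseteq S$ and $x^\infty\in\mathcal H$, $x^k\rightharpoonup x^\infty$ and $Ux^k-x^k\to0$ imply $x^\infty\in\operatorname{Fix}U$. $U$ is regular over $S$ if for every sequence $\{x^k\}\subseteq S$, $\|Ux^k-x^k\|\to0$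 implies $d(x^k,\operatorname{Fix}U)\to0$. $U$ is $\delta_S$-linearly regular over $S$, where $\delta_S>0$, if $\delta_S\, d(x,\operatorname{Fix}U)\le\|Ux-x\|$ for all $x\in S$. A family $\{C_1,\ldots,C_M\}$ of closed convex sets with nonempty intersection $C=\bigcap_{i}C_i$ is regular over $S$ if for every sequence $\{x^k\}\subseteq S$, $\max_i d(x^k,C_i)\to0$ implies $d(x^k,C)\to0$; it is $\kappa$-linearly regular over $S$, where $\kappa>0$, if $d(x,C)\le\kappa\max_i d(x,C_i)$ for all $x\in S$. $R$-linear convergence means $\|x^k-x^\infty\|\le cq^k$ for all $k$, for some $c>0$ and $q\in(0,1)$. *)

theory Defs
  imports "HOL-Analysis.Analysis"
begin

definition Fix :: "('a \<Rightarrow> 'a) \<Rightarrow> 'a set" where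
  "Fix U = {x. U x = x}"

text \<open>The library constant \<open>closest_point\<close> is restricted to Heine-Borel, hence
  finite-dimensional, spaces; this is the same definition without that restriction.\<close>

definition metric_projection :: "'a::real_inner set \<Rightarrow> 'a \<Rightarrow> 'a" where
  "metric_projection C x = (SOME z. z \<in> C \<and> (\<forall>y\<in>C. dist x z \<le> dist x y))"

definition weakly_converges :: "(nat \<Rightarrow> 'a::real_inner) \<Rightarrow> 'a \<Rightarrow> bool" where
  "weakly_converges x xinf \<longleftrightarrow> (\<forall>y. (\<lambda>k. x k \<bullet> y) \<longlonglongrightarrow> xinf \<bullet> y)"

definition R_linear_convergence :: "(nat \<Rightarrow> 'a::real_normed_vector) \<Rightarrow> 'a \<Rightarrow> bool" where
  "R_linear_convergence x xinf \<longleftrightarrow>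
     (\<exists>c>0. \<exists>q. 0 < q \<and> q < 1 \<and> (\<forall>k. norm (x k - xinf) \<le> c * q ^ k))"

definition cutter :: "('a::real_inner \<Rightarrow> 'a) \<Rightarrow> bool" where
  "cutter U \<longleftrightarrow> Fix U \<noteq> {} \<and> (\<forall>x. \<forall>z\<in>Fix U. (z - U x) \<bullet> (x - U x) \<le> 0)"

text \<open>The regularity notions below are meant for nonempty \<open>S\<close>, for operators with a fixed
  point and for families with nonempty intersection; \<open>infdist x A\<close> is \<open>d(x, A)\<close> when
  \<open>A\<close> is nonempty (and \<open>0\<close> by convention otherwise).\<close>

definition weakly_regular_over :: "('a::real_inner \<Rightarrow> 'a) \<Rightarrow> 'a set \<Rightarrow> bool" where
  "weakly_regular_over U S \<longleftrightarrow>
     (\<forall>x xinf. range x \<subseteq> S \<longrightarrow> weakly_converges x xinf \<longrightarrow>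
        (\<lambda>k. U (x k) - x k) \<longlonglongrightarrow> 0 \<longrightarrow> xinf \<in> Fix U)"

definition regular_over :: "('a::real_inner \<Rightarrow> 'a) \<Rightarrow> 'a set \<Rightarrow> bool" where
  "regular_over U S \<longleftrightarrow>
     (\<forall>x. range x \<subseteq> S \<longrightarrow> (\<lambda>k::nat. norm (U (x k) - x k)) \<longlonglongrightarrow> 0 \<longrightarrow>
        (\<lambda>k. infdist (x k) (Fix U)) \<longlonglongrightarrow> 0)"

definition linearly_regular_over :: "real \<Rightarrow> ('a::real_inner \<Rightarrow> 'a) \<Rightarrow> 'a set \<Rightarrow> bool" where
  "linearly_regular_over \<delta> U S \<longleftrightarrow>
     \<delta> > 0 \<and> (\<forall>x\<in>S. \<delta> * infdist x (Fix U) \<le> norm (U x - x))"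

definition regular_family_over :: "'i set \<Rightarrow> ('i \<Rightarrow> 'a::real_inner set) \<Rightarrow> 'a set \<Rightarrow> bool" where
  "regular_family_over I C S \<longleftrightarrow>
     (\<forall>x. range x \<subseteq> S \<longrightarrow> (\<lambda>k::nat. MAX i\<in>I. infdist (x k) (C i)) \<longlonglongrightarrow> 0 \<longrightarrow>
        (\<lambda>k. infdist (x k) (\<Inter>i\<in>I. C i)) \<longlonglongrightarrow> 0)"

definition linearly_regular_family_over ::
    "real \<Rightarrow> 'i set \<Rightarrow> ('i \<Rightarrow> 'a::real_inner set) \<Rightarrow> 'a set \<Rightarrow> bool" where
  "linearly_regular_family_over \<kappa> I C S \<longleftrightarrow>
     \<kappa> > 0 \<and> (\<forall>x\<in>S. infdist x (\<Inter>i\<in>I. C i) \<le> \<kappa> * (MAX i\<in>I. infdist x (C i)))"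

text \<open>An ordered subset of \<open>I\<close> is a list without repetitions.\<close>

definition is_string :: "'i set \<Rightarrow> 'i list \<Rightarrow> bool" where
  "is_string I J \<longleftrightarrow> J \<noteq> [] \<and> distinct J \<and> set J \<subseteq> I"

text \<open>\<open>fold\<close> applies the operator of the head of the string first.  The product of the
  first \<open>l\<close> operators is \<open>string_product U (take l J)\<close>, the identity for \<open>l = 0\<close>.\<close>

definition string_product :: "('i \<Rightarrow> 'a \<Rightarrow> 'a) \<Rightarrow> 'i list \<Rightarrow> 'a \<Rightarrow> 'a" where
  "string_product U J = fold U J"

text \<open>The following notions describe one iteration, with strings \<open>J 1, \<dots>, J N\<close> and
  weights \<open>w 1, \<dots>, w N\<close>.\<close>

definition string_average ::
    "('i \<Rightarrow> 'a \<Rightarrow> 'a) \<Rightarrow> nat \<Rightarrow> (nat \<Rightarrow> real) \<Rightarrow> (nat \<Rightarrow> 'i list) \<Rightarrow> 'a::real_inner \<Rightarrow> 'a" where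
  "string_average U N w J x = (\<Sum>n=1..N. w n *\<^sub>R string_product U (J n) x)"

definition active_indices :: "nat \<Rightarrow> (nat \<Rightarrow> 'i list) \<Rightarrow> 'i set" where
  "active_indices N J = (\<Union>n\<in>{1..N}. set (J n))"

definition max_string_length :: "nat \<Rightarrow> (nat \<Rightarrow> 'i list) \<Rightarrow> nat" where
  "max_string_length N J = (MAX n\<in>{1..N}. length (J n))"

definition extrapolation_bound ::
    "('i \<Rightarrow> 'a \<Rightarrow> 'a) \<Rightarrow> nat \<Rightarrow> (nat \<Rightarrow> real) \<Rightarrow> (nat \<Rightarrow> 'i list) \<Rightarrow> 'a::real_inner \<Rightarrow> real" where
  "extrapolation_bound U N w J x =
     (if x \<notin> (\<Inter>i\<in>active_indices N J. Fix (U i)) then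
        (real (max_string_length N J) / (real (max_string_length N J) + 1) *
           (\<Sum>n=1..N. w n *
              ((norm (string_product U (J n) x - x))\<^sup>2 +
               (\<Sum>l=1..length (J n).
                  (norm (string_product U (take l (J n)) x
                       - string_product U (take (l - 1) (J n)) x))\<^sup>2))))
        / (norm (string_average U N w J x - x))\<^sup>2
      else 1)"

definition intermittent_control :: "nat \<Rightarrow> 'i set \<Rightarrow> (nat \<Rightarrow> 'i set) \<Rightarrow> bool" where
  "intermittent_control s I Ik \<longleftrightarrow> s \<ge> 1 \<and> (\<forall>k. I = (\<Union>j\<in>{k..k + s - 1}. Ik j))"

end

theory Submission
  imports Defs "HOL-Library.Diagonal_Subsequence"
begin

text \<open>
  Two quantitative facts drive all three modes of convergence.

  First, one step of the method decreases \<open>\<parallel>x - z\<parallel>\<^sup>2\<close>, for every \<open>z \<in> C\<close>, by a controlled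
  amount.  Along a string of cutters the squared distance to \<open>z\<close> drops at least by the sum of
  the squared moves (\<open>string_norm_square_le\<close>).  Expanding the squares turns this into a lower
  bound for \<open>\<langle>T x - x, z - x\<rangle>\<close>.  The bounds \<open>\<sigma> \<le> \<tau>\<close> and \<open>\<lambda> < 1 + 1 / m\<close> keep the step shorter
  than the length at which the quadratic term would use up this gain (\<open>extrapolated_step\<close>).
  The decrease dominates \<open>\<rho> \<parallel>x\<^sup>+ - x\<parallel>\<^sup>2\<close> as well as \<open>\<Theta>\<close> times the weighted sum of squared moves inside
  the strings.

  Second, during \<open>s\<close> consecutive steps every operator \<open>U i\<close> is applied at some intermediate
  point \<open>u \<in> B\<close>, and both the distance from \<open>x k\<close> to \<open>u\<close> and the displacement
  \<open>U i u - u\<close> are sums of moves that the decrease of \<open>\<parallel>x - z\<parallel>\<^sup>2\<close> over these \<open>s\<close> steps pays for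
  (\<open>near_almost_fixed_point\<close>).

  The iterates are Fejer monotone with respect to \<open>C\<close>, so their distances to points of \<open>C\<close>
  converge, the decreases tend to \<open>0\<close>, and hence \<open>u - x k\<close> and \<open>U i u - u\<close> tend to \<open>0\<close>.
  Weak regularity then puts every weak cluster point in \<open>C\<close>, which for Fejer monotone sequences
  forces weak convergence of the whole sequence.  Regularity gives instead that the distance
  from \<open>x k\<close> to \<open>C\<close> tends to \<open>0\<close>, which for Fejer monotone sequences means convergence in
  norm.  Under linear regularity the same estimate, squared and taken with \<open>z\<close> the point of \<open>C\<close>
  nearest to \<open>x k\<close>, bounds the squared distance to \<open>C\<close> by a multiple of its own decrease over
  \<open>s\<close> steps, which is geometric decay (\<open>infdist_decay\<close>).

  In infinite dimension the weak part needs that bounded sequences have weakly convergent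
  subsequences, which is derived here from the nearest point property.
\<close>

section \<open>Nearest points and weak sequential compactness\<close>

lemma parallelogram_about:
  fixes u v a :: "'a::real_inner"
  shows "(dist u v)\<^sup>2 = 2 * (dist a u)\<^sup>2 + 2 * (dist a v)\<^sup>2 - 4 * (dist a (midpoint u v))\<^sup>2"
proof -
  have "a - midpoint u v = (1/2) *\<^sub>R ((a - u) + (a - v))"
    by (simp add: midpoint_def algebra_simps flip: scaleR_2)
  then have "4 * (norm (a - midpoint u v))\<^sup>2 = (norm ((a - u) + (a - v)))\<^sup>2"
    by (simp add: power_mult_distrib power_divide)
  moreover have "(norm (u - v))\<^sup>2 = (norm ((a - u) - (a - v)))\<^sup>2"
    by (simp add: norm_minus_commute)
  ultimately show ?thesis
    by (simp add: dist_norm power2_norm_eq_inner inner_diff inner_add inner_commute algebra_simps)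
qed

text \<open>
  A single completeness argument yields both the projection onto one closed convex set (take a
  constant family) and a common point of a bounded nested family.  The parallelogram identity
  bounds the diameter of the set of almost nearest points of \<open>K n\<close>, because the midpoint of two
  of them stays in \<open>K n\<close> and so is not closer to \<open>a\<close> than \<open>infdist a (K n)\<close>.
\<close>

lemma nested_closed_convex_nearest_point:
  fixes K :: "nat \<Rightarrow> 'a::{real_inner, banach} set"
  assumes cl: "\<And>n. closed (K n)" and cv: "\<And>n. convex (K n)" and ne: "\<And>n. K n \<noteq> {}"
    and mono: "\<And>m n. m \<le> n \<Longrightarrow> K n \<subseteq> K m"
    and lim: "(\<lambda>n. infdist a (K n)) \<longlonglongrightarrow> d"
  obtains p where "\<And>n. p \<in> K n" "dist a p \<le> d"
proof -
  have "incseq (\<lambda>n. infdist a (K n))"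
    unfolding incseq_def by (intro allI impI infdist_mono mono ne)
  then have le: "infdist a (K n) \<le> d" for n
    using lim incseq_le by blast
  have d0: "0 \<le> d"
    using le[of 0] infdist_nonneg order_trans by blast
  define S where "S n = K n \<inter> cball a (d + inverse (real (Suc n)))" for n
  have Sne: "S n \<noteq> {}" for n
  proof -
    have "infdist a (K n) < d + inverse (real (Suc n))"
      by (rule le_less_trans[OF le]) simp
    then have "(INF u\<in>K n. dist a u) < d + inverse (real (Suc n))"
      by (simp only: infdist_notempty[OF ne])
    then obtain u where "u \<in> K n" "dist a u < d + inverse (real (Suc n))"
      by (subst (asm) cINF_less_iff[OF ne bdd_below_image_dist]) blast
    then have "u \<in> S n"
      by (simp add: S_def del: of_nat_Suc)
    then show ?thesis by blast
  qed
  have small: "\<exists>n. \<forall>u\<in>S n. \<forall>v\<in>S n. dist u v < e" if "e > 0" for e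
  proof -
    have "(\<lambda>n. 4 * (d + inverse (real (Suc n)))\<^sup>2 - 4 * (infdist a (K n))\<^sup>2)
            \<longlonglongrightarrow> 4 * (d + 0)\<^sup>2 - 4 * d\<^sup>2"
      by (intro tendsto_intros lim LIMSEQ_inverse_real_of_nat)
    then have "\<forall>\<^sub>F n in sequentially. 4 * (d + inverse (real (Suc n)))\<^sup>2 - 4 * (infdist a (K n))\<^sup>2 < e\<^sup>2"
      using that by (intro order_tendstoD(2)) auto
    then obtain n where n: "4 * (d + inverse (real (Suc n)))\<^sup>2 - 4 * (infdist a (K n))\<^sup>2 < e\<^sup>2"
      by (auto simp: eventually_sequentially)
    have "dist u v < e" if u: "u \<in> S n" and v: "v \<in> S n" for u v
    proof -
      have "midpoint u v \<in> K n"
        using u v convexD[OF cv[of n], of u v "1/2" "1/2"]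
        by (simp add: S_def midpoint_def scaleR_add_right)
      then have "infdist a (K n) \<le> dist a (midpoint u v)"
        by (rule infdist_le)
      then have "(infdist a (K n))\<^sup>2 \<le> (dist a (midpoint u v))\<^sup>2"
        by (intro power_mono infdist_nonneg)
      moreover have "(dist a u)\<^sup>2 \<le> (d + inverse (real (Suc n)))\<^sup>2"
          "(dist a v)\<^sup>2 \<le> (d + inverse (real (Suc n)))\<^sup>2"
        using u v by (auto simp: S_def intro!: power_mono)
      ultimately have "(dist u v)\<^sup>2 < e\<^sup>2"
        using n parallelogram_about[of u v a] by linarith
      then show ?thesis
        using \<open>e > 0\<close> by (simp add: power_less_imp_less_base)
    qed
    then show ?thesis by blast
  qed
  obtain p where p: "\<And>n. p \<in> S n"
  proof (rule decreasing_closed_nest[of S])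
    show "closed (S n)" for n
      by (simp add: S_def cl closed_Int)
    show "S n \<subseteq> S m" if "m \<le> n" for m n
      unfolding S_def using that by (intro Int_mono mono subset_cball add_left_mono le_imp_inverse_le) simp_all
  qed (use Sne small in auto)
  have "dist a p \<le> d + inverse (real (Suc n))" for n
    using p[of n] by (simp add: S_def)
  moreover have "(\<lambda>n. d + inverse (real (Suc n))) \<longlonglongrightarrow> d + 0"
    by (intro tendsto_intros LIMSEQ_inverse_real_of_nat)
  ultimately have "dist a p \<le> d"
    by (intro LIMSEQ_le_const[of _ d]) auto
  with p that show thesis
    by (auto simp: S_def)
qed

lemma nearest_point_exists:
  fixes S :: "'a::{real_inner, banach} set"
  assumes "closed S" "convex S" "S \<noteq> {}"
  obtains p where "p \<in> S" "dist a p = infdist a S"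
proof -
  obtain p where "p \<in> S" "dist a p \<le> infdist a S"
    using nested_closed_convex_nearest_point[of "\<lambda>_. S" a "infdist a S"] assms by auto
  then show thesis
    using that infdist_le[of p S a] by fastforce
qed

lemma bounded_nested_closed_convex_nonempty:
  fixes K :: "nat \<Rightarrow> 'a::{real_inner, banach} set"
  assumes "\<And>n. closed (K n)" "\<And>n. convex (K n)" and ne: "\<And>n. K n \<noteq> {}"
    and mono: "\<And>m n. m \<le> n \<Longrightarrow> K n \<subseteq> K m" and bdd: "bounded (K 0)"
  obtains p where "\<And>n. p \<in> K n"
proof -
  obtain R where R: "\<And>u. u \<in> K 0 \<Longrightarrow> norm u \<le> R"
    using bdd by (auto simp: bounded_iff)
  have "infdist 0 (K n) \<le> R" for n
  proof -
    obtain u where "u \<in> K n" using ne by blast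
    with mono[of 0 n] R infdist_le2[of u "K n" 0 R] show ?thesis by auto
  qed
  moreover have "incseq (\<lambda>n. infdist 0 (K n))"
    unfolding incseq_def by (intro allI impI infdist_mono mono ne)
  ultimately obtain d where d: "(\<lambda>n. infdist 0 (K n)) \<longlonglongrightarrow> d"
    by (elim incseq_convergent) auto
  show thesis
    using nested_closed_convex_nearest_point[OF assms(1-4) d] that by auto
qed

text \<open>
  Otherwise moving from \<open>p\<close> a little within \<open>V\<close> would come closer to \<open>a\<close>.
\<close>

lemma residual_orthogonal:
  fixes V :: "'a::real_inner set"
  assumes V: "subspace V" and p: "p \<in> V" and min: "dist a p = infdist a V" and v: "v \<in> V"
  shows "(a - p) \<bullet> v = 0"
proof -
  have "(a - p) \<bullet> (u - p) \<le> 0" if u: "u \<in> V" for u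
  proof (rule ccontr)
    assume "\<not> (a - p) \<bullet> (u - p) \<le> 0"
    then have "(a - p) \<bullet> (u - p) > 0" by simp
    then obtain t where t: "t > 0" "t \<le> 1" "dist (p + t *\<^sub>R (u - p)) a < dist p a"
      using closer_point_lemma[of "a" p u] by (auto simp: dist_commute)
    have "p + t *\<^sub>R (u - p) \<in> V"
      using V p u by (intro subspace_add subspace_scale subspace_diff)
    from infdist_le[OF this, of a] t(3) min show False by (simp add: dist_commute)
  qed
  from this[of "p + v"] this[of "p - v"] show ?thesis
    using V p v by (simp add: subspace_add subspace_diff)
qed

text \<open>
  For a bounded sequence the map \<open>y \<mapsto> x k \<bullet> y\<close> is Lipschitz uniformly in \<open>k\<close>, so convergence
  at nearby vectors transfers to the limit.
\<close>

lemma weakly_testable_closed: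
  fixes x :: "nat \<Rightarrow> 'a::real_inner"
  assumes bdd: "bounded (range x)"
  shows "closed {y. (\<lambda>k. x k \<bullet> y) \<longlonglongrightarrow> z \<bullet> y}" (is "closed ?V")
proof -
  obtain R where R: "R > 0" "\<And>k. norm (x k) \<le> R"
    using bdd by (auto simp: bounded_pos)
  have "y \<in> ?V" if y: "y \<in> closure ?V" for y
  proof -
    have "\<exists>n. \<forall>k\<ge>n. norm (x k \<bullet> y - z \<bullet> y) < e" if "e > 0" for e :: real
    proof -
      define h where "h = e / 2 / (R + norm z)"
      have Rz: "R + norm z > 0"
        using R(1) norm_ge_zero[of z] by linarith
      then have h: "h > 0"
        using \<open>e > 0\<close> by (simp add: h_def)
      have hR: "(R + norm z) * h = e / 2"
        using Rz unfolding h_def by (metis less_irrefl nonzero_mult_div_cancel_left times_divide_eq_right)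
      obtain v where v: "v \<in> ?V" "dist v y < h"
        using y h closure_approachable by blast
      have "(\<lambda>k. x k \<bullet> v) \<longlonglongrightarrow> z \<bullet> v"
        using v(1) by simp
      from LIMSEQ_D[OF this half_gt_zero[OF \<open>e > 0\<close>]]
      obtain n where n: "\<And>k. k \<ge> n \<Longrightarrow> norm (x k \<bullet> v - z \<bullet> v) < e / 2"
        by blast
      have "norm (x k \<bullet> y - z \<bullet> y) < e" if "k \<ge> n" for k
      proof -
        have "x k \<bullet> y - z \<bullet> y = (x k \<bullet> v - z \<bullet> v) + (x k - z) \<bullet> (y - v)"
          by (simp add: inner_diff)
        then have "norm (x k \<bullet> y - z \<bullet> y) \<le> norm (x k \<bullet> v - z \<bullet> v) + norm ((x k - z) \<bullet> (y - v))"
          using norm_triangle_ineq by metis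
        also have "norm ((x k - z) \<bullet> (y - v)) \<le> norm (x k - z) * norm (y - v)"
          by (simp add: Cauchy_Schwarz_ineq2)
        also have "\<dots> \<le> (R + norm z) * h"
        proof (rule mult_mono)
          show "norm (x k - z) \<le> R + norm z"
            using R(2)[of k] norm_triangle_ineq4[of "x k" z] by linarith
          show "norm (y - v) \<le> h"
            using v(2) by (simp add: dist_norm norm_minus_commute)
          show "0 \<le> R + norm z"
            using R(1) norm_ge_zero[of z] by linarith
        qed simp
        finally show ?thesis using n[OF that] hR by linarith
      qed
      then show ?thesis by blast
    qed
    then show ?thesis by (simp add: LIMSEQ_iff)
  qed
  then show ?thesis
    using closure_subset_eq[of ?V] by blast
qed

text \<open>
  A diagonal subsequence \<open>y\<close> makes all the numerical sequences \<open>y k \<bullet> x j\<close> converge.  The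
  candidate limit \<open>z\<close> is a common point of the closed convex hulls of the tails of \<open>y\<close>; such a
  point has the right inner product with every
  \<open>x j\<close>.  The vectors against which \<open>y\<close> converges to \<open>z\<close> form a closed subspace \<open>V\<close> containing
  all \<open>x j\<close> and \<open>z\<close>; a vector orthogonal to \<open>V\<close> is orthogonal to all of these, hence lies in
  \<open>V\<close> too, so \<open>V\<close> is the whole space.
\<close>

lemma bounded_imp_weakly_convergent_subseq:
  fixes x :: "nat \<Rightarrow> 'a::{real_inner, banach}"
  assumes bdd: "bounded (range x)"
  obtains f z where "strict_mono f" "weakly_converges (x \<circ> f) z"
proof -
  obtain R where R: "\<And>k. norm (x k) \<le> R"
    using bdd by (auto simp: bounded_iff)
  interpret subseqs "\<lambda>j f. convergent (\<lambda>k. x (f k) \<bullet> x j)"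
  proof
    fix j and f :: "nat \<Rightarrow> nat"
    have "bounded (range (\<lambda>k. x (f k) \<bullet> x j))"
      using bounded_linear_image[OF bdd bounded_linear_inner_left[of "x j"]]
      by (rule bounded_subset) auto
    then obtain l g where "strict_mono g" "((\<lambda>k. x (f k) \<bullet> x j) \<circ> g) \<longlonglongrightarrow> l"
      using bounded_imp_convergent_subsequence by blast
    then show "\<exists>g. strict_mono g \<and> convergent (\<lambda>k. x ((f \<circ> g) k) \<bullet> x j)"
      by (auto simp: o_def convergent_def)
  qed
  define f where "f = diagseq"
  define y where "y = x \<circ> f"
  have f: "strict_mono f"
    by (simp add: f_def subseq_diagseq)
  have yb: "bounded (range y)"
    by (rule bounded_subset[OF bdd]) (auto simp: y_def)
  have conv: "convergent (\<lambda>k. y k \<bullet> x j)" for j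
  proof -
    have "convergent (\<lambda>k. x ((diagseq \<circ> (+) (Suc j)) k) \<bullet> x j)"
    proof (rule diagseq_holds)
      show "convergent (\<lambda>k. x ((s \<circ> r) k) \<bullet> x n)"
        if "strict_mono r" "convergent (\<lambda>k. x (s k) \<bullet> x n)" for r s :: "nat \<Rightarrow> nat" and n
        using convergent_subseq_convergent[OF that(2,1)] by (simp add: o_def)
    qed
    then have "convergent (\<lambda>k. y (k + Suc j) \<bullet> x j)"
      by (simp add: y_def f_def o_def add.commute)
    then show ?thesis
      by (subst (asm) convergent_ignore_initial_segment)
  qed
  define K where "K n = closure (convex hull (y ` {n..}))" for n
  obtain z where z: "\<And>n. z \<in> K n"
  proof (rule bounded_nested_closed_convex_nonempty[of K])
    show "K n \<subseteq> K m" if "m \<le> n" for m n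
      unfolding K_def using that by (intro closure_mono hull_mono image_mono) auto
    show "bounded (K 0)"
      using bounded_subset[OF yb, of "y ` {0..}"] by (auto simp: K_def intro: bounded_closure bounded_convex_hull)
  qed (auto simp: K_def convex_closure)
  define V where "V = {v. (\<lambda>k. y k \<bullet> v) \<longlonglongrightarrow> z \<bullet> v}"
  have xV: "x j \<in> V" for j
  proof -
    obtain l where l: "(\<lambda>k. y k \<bullet> x j) \<longlonglongrightarrow> l"
      using conv convergent_def by blast
    have "dist (z \<bullet> x j) l \<le> e" if e: "e > 0" for e
    proof -
      from metric_LIMSEQ_D[OF l e]
      obtain n where n: "\<And>k. k \<ge> n \<Longrightarrow> dist (y k \<bullet> x j) l < e"
        by blast
      define H where "H = {u. l - e \<le> x j \<bullet> u} \<inter> {u. x j \<bullet> u \<le> l + e}"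
      have "closed H" "convex H"
        unfolding H_def
        by (intro closed_Int convex_Int closed_halfspace_le closed_halfspace_ge
            convex_halfspace_le convex_halfspace_ge[of "l - e" "x j"])+
      moreover have "y ` {n..} \<subseteq> H"
      proof
        fix u assume "u \<in> y ` {n..}"
        then obtain k where "k \<ge> n" "u = y k" by blast
        with n[of k] show "u \<in> H"
          by (simp add: H_def dist_real_def inner_commute abs_less_iff)
      qed
      ultimately have "K n \<subseteq> H"
        unfolding K_def by (intro closure_minimal hull_minimal)
      then show ?thesis
        using z[of n] by (auto simp: H_def dist_real_def inner_commute abs_le_iff)
    qed
    then have "z \<bullet> x j = l"
      using field_le_epsilon[of "dist (z \<bullet> x j) l" 0] by simp
    with l show ?thesis by (simp add: V_def)
  qed
  have V: "closed V" "subspace V"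
    unfolding V_def using weakly_testable_closed[OF yb]
    by (auto simp: subspace_def inner_add_right intro: tendsto_add tendsto_mult_left)
  have "K 0 \<subseteq> V"
    unfolding K_def using xV V by (intro closure_minimal hull_minimal subspace_imp_convex) (auto simp: y_def)
  then have zV: "z \<in> V" using z by blast
  have "v \<in> V" for v
  proof -
    obtain p where p: "p \<in> V" "dist v p = infdist v V"
      using nearest_point_exists[of V v] V xV by (auto simp: subspace_imp_convex)
    have orth: "(v - p) \<bullet> u = 0" if "u \<in> V" for u
      using residual_orthogonal[OF V(2) p that] .
    have "y k \<bullet> (v - p) = 0" for k
      using orth[OF xV[of "f k"]] by (simp add: y_def inner_commute)
    moreover have "z \<bullet> (v - p) = 0"
      using orth[OF zV] by (simp add: inner_commute)
    ultimately have "v - p \<in> V"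
      by (simp add: V_def)
    from subspace_add[OF V(2) p(1) this] show ?thesis by simp
  qed
  then have "weakly_converges y z"
    by (auto simp: weakly_converges_def V_def)
  with f that show thesis by (simp add: y_def)
qed

section \<open>Fejer monotone sequences\<close>

definition fejer_monotone :: "'a::real_normed_vector set \<Rightarrow> (nat \<Rightarrow> 'a) \<Rightarrow> bool" where
  "fejer_monotone C x \<longleftrightarrow> (\<forall>z\<in>C. decseq (\<lambda>k. norm (x k - z)))"

lemma fejer_monotoneD:
  "fejer_monotone C x \<Longrightarrow> z \<in> C \<Longrightarrow> k \<le> l \<Longrightarrow> norm (x l - z) \<le> norm (x k - z)"
  by (auto simp: fejer_monotone_def decseq_def)

lemma fejer_convergent:
  assumes "fejer_monotone C x" "z \<in> C"
  shows "convergent (\<lambda>k. norm (x k - z))"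
proof -
  have "decseq (\<lambda>k. norm (x k - z))"
    using assms by (simp add: fejer_monotone_def)
  then obtain l where "(\<lambda>k. norm (x k - z)) \<longlonglongrightarrow> l"
    using decseq_convergent[of "\<lambda>k. norm (x k - z)" 0] by auto
  then show ?thesis by (rule convergentI)
qed

lemma fejer_bounded:
  assumes "fejer_monotone C x" "z \<in> C"
  shows "bounded (range x)"
proof -
  have "norm (x k) \<le> norm (x 0 - z) + norm z" for k
    using fejer_monotoneD[OF assms, of 0 k] norm_triangle_ineq[of "x k - z" z] by simp
  then show ?thesis by (auto simp: bounded_iff)
qed

text \<open>
  The difference of \<open>\<parallel>x k - z'\<parallel>\<^sup>2\<close> and \<open>\<parallel>x k - z\<parallel>\<^sup>2\<close> is affine in \<open>x k\<close>, so \<open>x k \<bullet> (z - z')\<close>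
  converges.  Evaluating the limit along both subsequences gives
  \<open>z \<bullet> (z - z') = z' \<bullet> (z - z')\<close>.
\<close>

lemma fejer_weak_cluster_points_eq:
  fixes x :: "nat \<Rightarrow> 'a::real_inner"
  assumes fm: "fejer_monotone C x"
    and f: "strict_mono f" "weakly_converges (x \<circ> f) z" "z \<in> C"
    and g: "strict_mono g" "weakly_converges (x \<circ> g) z'" "z' \<in> C"
  shows "z = z'"
proof -
  have "convergent (\<lambda>k. x k \<bullet> (z - z'))"
  proof -
    have eq: "x k \<bullet> (z - z') =
        ((norm (x k - z'))\<^sup>2 - (norm (x k - z))\<^sup>2 + (norm z)\<^sup>2 - (norm z')\<^sup>2) / 2" for k
      by (simp add: power2_norm_eq_inner inner_diff inner_commute)
    obtain a b where "(\<lambda>k. norm (x k - z')) \<longlonglongrightarrow> a" "(\<lambda>k. norm (x k - z)) \<longlonglongrightarrow> b"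
      using fejer_convergent[OF fm f(3)] fejer_convergent[OF fm g(3)] by (auto simp: convergent_def)
    then have "(\<lambda>k. ((norm (x k - z'))\<^sup>2 - (norm (x k - z))\<^sup>2 + (norm z)\<^sup>2 - (norm z')\<^sup>2) / 2)
        \<longlonglongrightarrow> (a\<^sup>2 - b\<^sup>2 + (norm z)\<^sup>2 - (norm z')\<^sup>2) / 2"
      by (intro tendsto_intros) auto
    then show ?thesis unfolding eq by (rule convergentI)
  qed
  then obtain l where l: "(\<lambda>k. x k \<bullet> (z - z')) \<longlonglongrightarrow> l"
    by (auto simp: convergent_def)
  have "(\<lambda>k. (x \<circ> h) k \<bullet> (z - z')) \<longlonglongrightarrow> l" if "strict_mono h" for h
    using LIMSEQ_subseq_LIMSEQ[OF l that] by (simp add: o_def)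
  with f g have "l = z \<bullet> (z - z')" "l = z' \<bullet> (z - z')"
    by (auto simp: weakly_converges_def intro: LIMSEQ_unique)
  then have "(z - z') \<bullet> (z - z') = 0"
    by (simp add: inner_diff_left)
  then show ?thesis by simp
qed

text \<open>
  Opial's argument: a subsequence staying away from the unique cluster point would itself have a
  weakly convergent subsequence, whose limit is again that cluster point.
\<close>

lemma fejer_weakly_converges:
  fixes x :: "nat \<Rightarrow> 'a::{real_inner, banach}"
  assumes fm: "fejer_monotone C x" and ne: "C \<noteq> {}"
    and cluster: "\<And>f z. strict_mono f \<Longrightarrow> weakly_converges (x \<circ> f) z \<Longrightarrow> z \<in> C"
  obtains z where "z \<in> C" "weakly_converges x z"
proof -
  obtain c where "c \<in> C" using ne by blast
  then have bdd: "bounded (range x)"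
    using fejer_bounded fm by blast
  have sub: "bounded (range (x \<circ> f))" for f :: "nat \<Rightarrow> nat"
    by (rule bounded_subset[OF bdd]) auto
  obtain f z where f: "strict_mono f" "weakly_converges (x \<circ> f) z"
    using bounded_imp_weakly_convergent_subseq[OF bdd] .
  have "(\<lambda>k. x k \<bullet> y) \<longlonglongrightarrow> z \<bullet> y" for y
  proof (rule ccontr)
    assume "\<not> (\<lambda>k. x k \<bullet> y) \<longlonglongrightarrow> z \<bullet> y"
    then obtain e where e: "e > 0" "\<And>n. \<exists>k\<ge>n. \<not> norm (x k \<bullet> y - z \<bullet> y) < e"
      by (auto simp: LIMSEQ_iff)
    then have "infinite {k. \<not> norm (x k \<bullet> y - z \<bullet> y) < e}"
      by (auto simp: infinite_nat_iff_unbounded_le)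
    from infinite_enumerate[OF this] obtain g :: "nat \<Rightarrow> nat"
      where g: "strict_mono g" "\<And>n. g n \<in> {k. \<not> norm (x k \<bullet> y - z \<bullet> y) < e}"
      by blast
    obtain h z' where h: "strict_mono h" "weakly_converges ((x \<circ> g) \<circ> h) z'"
      using bounded_imp_weakly_convergent_subseq[OF sub[of g]] .
    have gh: "strict_mono (g \<circ> h)" "weakly_converges (x \<circ> (g \<circ> h)) z'"
      using g(1) h by (auto intro: strict_mono_o simp: o_assoc)
    have "z' = z"
      using fejer_weak_cluster_points_eq[OF fm gh cluster[OF gh] f cluster[OF f]] .
    then have "(\<lambda>k. x (g (h k)) \<bullet> y) \<longlonglongrightarrow> z \<bullet> y"
      using gh(2) by (simp add: weakly_converges_def)
    from LIMSEQ_D[OF this e(1)] obtain k where "norm (x (g (h k)) \<bullet> y - z \<bullet> y) < e"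
      by blast
    with g(2)[of "h k"] show False by simp
  qed
  then have "weakly_converges x z"
    by (simp add: weakly_converges_def)
  with cluster[OF f] that show thesis by blast
qed

lemma infdist_attained_approx:
  fixes A :: "'a::metric_space set"
  assumes "A \<noteq> {}" "e > 0"
  obtains z where "z \<in> A" "dist a z < infdist a A + e"
proof -
  have "(INF z\<in>A. dist a z) < infdist a A + e"
    using assms by (simp add: infdist_notempty)
  then show thesis
    using that by (subst (asm) cINF_less_iff[OF assms(1) bdd_below_image_dist]) blast
qed

lemma fejer_infdist_mono:
  assumes "fejer_monotone C x" "C \<noteq> {}" "k \<le> l"
  shows "infdist (x l) C \<le> infdist (x k) C"
proof (rule field_le_epsilon)
  fix e :: real assume "e > 0"
  then obtain z where z: "z \<in> C" "dist (x k) z < infdist (x k) C + e"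
    using infdist_attained_approx assms(2) by blast
  have "infdist (x l) C \<le> dist (x l) z"
    using z(1) by (rule infdist_le)
  also have "\<dots> \<le> dist (x k) z"
    using fejer_monotoneD[OF assms(1) z(1) assms(3)] by (simp add: dist_norm)
  finally show "infdist (x l) C \<le> infdist (x k) C + e"
    using z(2) by simp
qed

text \<open>
  Both \<open>x k\<close> and \<open>x l\<close> are within \<open>dist (x k) z\<close> of every \<open>z \<in> C\<close>; the factor \<open>2\<close> in the
  linear rate has its origin here.
\<close>

lemma fejer_dist_le:
  assumes "fejer_monotone C x" "C \<noteq> {}" "k \<le> l"
  shows "dist (x k) (x l) \<le> 2 * infdist (x k) C"
proof (rule field_le_epsilon)
  fix e :: real assume "e > 0"
  then obtain z where z: "z \<in> C" "dist (x k) z < infdist (x k) C + e / 2"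
    using infdist_attained_approx[OF assms(2), of "e / 2"] by auto
  have "dist (x k) (x l) \<le> dist (x k) z + dist (x l) z"
    by (rule dist_triangle2)
  also have "dist (x l) z \<le> dist (x k) z"
    using fejer_monotoneD[OF assms(1) z(1) assms(3)] by (simp add: dist_norm)
  finally show "dist (x k) (x l) \<le> 2 * infdist (x k) C + e"
    using z(2) by simp
qed

lemma fejer_strongly_converges:
  fixes x :: "nat \<Rightarrow> 'a::banach"
  assumes fm: "fejer_monotone C x" and C: "closed C" "C \<noteq> {}"
    and lim: "(\<lambda>k. infdist (x k) C) \<longlonglongrightarrow> 0"
  obtains z where "z \<in> C" "x \<longlonglongrightarrow> z" "\<And>k. norm (x k - z) \<le> 2 * infdist (x k) C"
proof -
  have "Cauchy x"
  proof (rule CauchyI')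
    fix e :: real assume "e > 0"
    then have "\<forall>\<^sub>F k in sequentially. infdist (x k) C < e / 2"
      using lim by (intro order_tendstoD) auto
    then obtain M where M: "\<And>k. k \<ge> M \<Longrightarrow> infdist (x k) C < e / 2"
      by (auto simp: eventually_sequentially)
    have "dist (x k) (x l) < e" if "k \<ge> M" "k < l" for k l
      using M[OF that(1)] fejer_dist_le[OF fm C(2), of k l] that(2) by simp
    then show "\<exists>M. \<forall>k\<ge>M. \<forall>l>k. dist (x k) (x l) < e"
      by blast
  qed
  then obtain z where z: "x \<longlonglongrightarrow> z"
    by (auto simp: Cauchy_convergent_iff convergent_def)
  have "(\<lambda>k. infdist (x k) C) \<longlonglongrightarrow> infdist z C"
    using z by (intro tendsto_infdist)
  then have "infdist z C = 0"
    using lim LIMSEQ_unique by blast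
  then have "z \<in> C"
    using C by (simp add: in_closed_iff_infdist_zero)
  moreover have "norm (x k - z) \<le> 2 * infdist (x k) C" for k
  proof -
    have "(\<lambda>l. dist (x k) (x l)) \<longlonglongrightarrow> dist (x k) z"
      using z by (intro tendsto_intros)
    moreover have "\<forall>l\<ge>k. dist (x k) (x l) \<le> 2 * infdist (x k) C"
      using fejer_dist_le[OF fm C(2)] by blast
    ultimately have "dist (x k) z \<le> 2 * infdist (x k) C"
      by (intro LIMSEQ_le_const2[of _ "dist (x k) z"]) auto
    then show ?thesis by (simp add: dist_norm)
  qed
  ultimately show thesis using that z by blast
qed

text \<open>
  By the Cauchy-Schwarz inequality \<open>(x k - c) \<bullet> (z - c) \<le> r * norm (z - c)\<close>, and the left-hand side
  tends to \<open>(norm (z - c))\<^sup>2\<close>.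
\<close>

lemma weak_limit_in_cball:
  fixes x :: "nat \<Rightarrow> 'a::real_inner"
  assumes "weakly_converges x z" "\<And>k. x k \<in> cball c r"
  shows "z \<in> cball c r"
proof -
  have r: "norm (x k - c) \<le> r" for k
    using assms(2)[of k] by (simp add: dist_norm norm_minus_commute)
  have "(\<lambda>k. x k \<bullet> (z - c) - c \<bullet> (z - c)) \<longlonglongrightarrow> z \<bullet> (z - c) - c \<bullet> (z - c)"
    using assms(1) unfolding weakly_converges_def by (intro tendsto_diff tendsto_const) blast
  moreover have "x k \<bullet> (z - c) - c \<bullet> (z - c) \<le> r * norm (z - c)" for k
    using norm_cauchy_schwarz[of "x k - c" "z - c"] mult_right_mono[OF r[of k] norm_ge_zero[of "z - c"]]
    by (simp add: inner_diff_left)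
  ultimately have "z \<bullet> (z - c) - c \<bullet> (z - c) \<le> r * norm (z - c)"
    by (intro LIMSEQ_le_const2[where X="\<lambda>k. x k \<bullet> (z - c) - c \<bullet> (z - c)"]) auto
  then have "norm (z - c) * norm (z - c) \<le> r * norm (z - c)"
    by (simp add: inner_diff_left[symmetric] power2_norm_eq_inner[symmetric] power2_eq_square)
  moreover have "0 \<le> r"
    using r[of 0] norm_ge_zero[of "x 0 - c"] by linarith
  ultimately have "norm (z - c) \<le> r"
    by (cases "norm (z - c) = 0") (auto simp: mult_le_cancel_right)
  then show ?thesis by (simp add: dist_norm norm_minus_commute)
qed

section \<open>Cutters\<close>

lemma cutter_inner_ge:
  assumes "cutter U" "z \<in> Fix U"
  shows "(norm (U x - x))\<^sup>2 \<le> (U x - x) \<bullet> (z - x)"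
proof -
  have "(z - U x) \<bullet> (x - U x) \<le> 0"
    using assms by (simp add: cutter_def)
  then show ?thesis
    by (simp add: power2_norm_eq_inner inner_diff inner_commute)
qed

lemma cutter_norm_square_le:
  assumes "cutter U" "z \<in> Fix U"
  shows "(norm (U x - z))\<^sup>2 + (norm (U x - x))\<^sup>2 \<le> (norm (x - z))\<^sup>2"
proof -
  have "(norm (x - z))\<^sup>2 - (norm (U x - z))\<^sup>2 = 2 * ((U x - x) \<bullet> (z - x)) - (norm (U x - x))\<^sup>2"
    by (simp add: power2_norm_eq_inner inner_diff inner_commute)
  then show ?thesis
    using cutter_inner_ge[OF assms, of x] by linarith
qed

lemma cutter_displacement_le:
  assumes "cutter U" "z \<in> Fix U"
  shows "norm (U x - x) \<le> norm (x - z)"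
proof -
  have "(norm (U x - x))\<^sup>2 \<le> (norm (x - z))\<^sup>2"
    using cutter_norm_square_le[OF assms, of x] zero_le_power2[of "norm (U x - z)"] by linarith
  then show ?thesis by (simp add: power2_le_iff_abs_le)
qed

text \<open>
  The inequality defining a cutter is affine in the fixed point \<open>z\<close>.  Conversely, a point \<open>z\<close>
  satisfying it for all \<open>x\<close> satisfies it for \<open>x = z\<close>, where it reads \<open>\<parallel>z - U z\<parallel>\<^sup>2 \<le> 0\<close>.
\<close>

lemma cutter_Fix_eq_halfspaces:
  assumes "cutter U"
  shows "Fix U = (\<Inter>x. {z. (x - U x) \<bullet> z \<le> (x - U x) \<bullet> U x})"
proof (intro equalityI subsetI)
  fix z assume "z \<in> Fix U"
  then have "(z - U x) \<bullet> (x - U x) \<le> 0" for x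
    using assms by (simp add: cutter_def)
  then show "z \<in> (\<Inter>x. {z. (x - U x) \<bullet> z \<le> (x - U x) \<bullet> U x})"
    by (simp add: inner_diff_left inner_diff_right inner_commute algebra_simps)
next
  fix z assume "z \<in> (\<Inter>x. {z. (x - U x) \<bullet> z \<le> (x - U x) \<bullet> U x})"
  then have "(z - U z) \<bullet> z \<le> (z - U z) \<bullet> U z"
    by blast
  then have "(z - U z) \<bullet> (z - U z) \<le> 0"
    by (simp only: inner_diff_right[of _ z "U z"])
  then show "z \<in> Fix U"
    using inner_ge_zero[of "z - U z"] by (simp add: Fix_def)
qed

lemma closed_Fix_cutter: "cutter U \<Longrightarrow> closed (Fix U)"
  by (simp add: cutter_Fix_eq_halfspaces closed_INT closed_halfspace_le)

lemma convex_Fix_cutter: "cutter U \<Longrightarrow> convex (Fix U)"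
  by (simp add: cutter_Fix_eq_halfspaces convex_INT convex_halfspace_le)

section \<open>Products of cutters along strings\<close>

definition string_energy :: "('i \<Rightarrow> 'a \<Rightarrow> 'a) \<Rightarrow> 'i list \<Rightarrow> 'a::real_inner \<Rightarrow> real" where
  "string_energy U J x =
     (\<Sum>l=1..length J. (norm (string_product U (take l J) x - string_product U (take (l - 1) J) x))\<^sup>2)"

lemma string_product_take_Suc:
  "l < length J \<Longrightarrow> string_product U (take (Suc l) J) x = U (J ! l) (string_product U (take l J) x)"
  by (simp add: string_product_def take_Suc_conv_app_nth)

lemma string_energy_nonneg: "0 \<le> string_energy U J x"
  by (simp add: string_energy_def sum_nonneg)

lemma string_partial_norm_square_le:
  assumes "\<And>i. i \<in> set J \<Longrightarrow> cutter (U i)" "\<And>i. i \<in> set J \<Longrightarrow> z \<in> Fix (U i)" and "p \<le> length J"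
  shows "(norm (string_product U (take p J) x - z))\<^sup>2
       + (\<Sum>l=1..p. (norm (string_product U (take l J) x - string_product U (take (l - 1) J) x))\<^sup>2)
       \<le> (norm (x - z))\<^sup>2"
  using \<open>p \<le> length J\<close>
proof (induction p)
  case 0
  then show ?case by (simp add: string_product_def)
next
  case (Suc p)
  then have "J ! p \<in> set J" "string_product U (take (Suc p) J) x = U (J ! p) (string_product U (take p J) x)"
    by (auto simp: string_product_take_Suc)
  then show ?case
    using Suc cutter_norm_square_le[OF assms(1,2), of "J ! p" "string_product U (take p J) x"] by simp
qed

lemma string_norm_square_le:
  assumes "\<And>i. i \<in> set J \<Longrightarrow> cutter (U i)" "\<And>i. i \<in> set J \<Longrightarrow> z \<in> Fix (U i)"
  shows "(norm (string_product U J x - z))\<^sup>2 + string_energy U J x \<le> (norm (x - z))\<^sup>2"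
  using string_partial_norm_square_le[of J U z "length J" x] assms by (simp add: string_energy_def)

text \<open>
  Before \<open>U i\<close> is applied the path has only made the earlier moves of the string, and
  \<open>U i u - u\<close> is the next one.  The triangle inequality therefore bounds the sum by the length
  of the path, and the Cauchy-Schwarz inequality bounds the square of that length.
\<close>

lemma string_passes_near_every_index:
  assumes "i \<in> set J"
  obtains l where "l \<le> length J"
    "(norm (string_product U (take l J) x - x)
      + norm (U i (string_product U (take l J) x) - string_product U (take l J) x))\<^sup>2
      \<le> real (length J) * string_energy U J x"
proof -
  obtain l where l: "l < length J" "J ! l = i"
    using assms by (auto simp: in_set_conv_nth)
  define y where "y p = string_product U (take p J) x" for p
  have "y l - x = (\<Sum>p=1..l. y p - y (p - 1))"
  proof (induction l)
    case (Suc l)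
    have "y (Suc l) - x = (y l - x) + (y (Suc l) - y l)"
      by simp
    then show ?case using Suc.IH by simp
  qed (simp add: y_def string_product_def)
  then have "norm (y l - x) \<le> (\<Sum>p=1..l. norm (y p - y (p - 1)))"
    by (simp only: norm_sum)
  moreover have "U i (y l) = y (Suc l)"
    using l by (simp add: y_def string_product_take_Suc)
  ultimately have "norm (y l - x) + norm (U i (y l) - y l) \<le> (\<Sum>p=1..Suc l. norm (y p - y (p - 1)))"
    by simp
  also have "\<dots> \<le> (\<Sum>p=1..length J. norm (y p - y (p - 1)))"
    using l(1) by (intro sum_mono2) auto
  finally have "(norm (y l - x) + norm (U i (y l) - y l))\<^sup>2 \<le> (\<Sum>p=1..length J. norm (y p - y (p - 1)))\<^sup>2"
    by (intro power_mono) auto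
  also have "\<dots> \<le> real (length J) * (\<Sum>p=1..length J. (norm (y p - y (p - 1)))\<^sup>2)"
    using sum_squared_le_sum_of_squares[of "\<lambda>p. norm (y p - y (p - 1))" "{1..length J}"]
    by (simp add: mult.commute)
  finally show thesis
    using that[of l] l(1) by (simp add: y_def string_energy_def)
qed

section \<open>One extrapolated string averaging step\<close>

text \<open>
  The difference of the two sides is the variance of the \<open>a n\<close> about their weighted mean.
\<close>

lemma norm_square_weighted_mean_le:
  fixes a :: "'i \<Rightarrow> 'a::real_inner"
  assumes "\<And>n. n \<in> S \<Longrightarrow> 0 \<le> w n" "(\<Sum>n\<in>S. w n) = 1"
  shows "(norm (\<Sum>n\<in>S. w n *\<^sub>R a n))\<^sup>2 \<le> (\<Sum>n\<in>S. w n * (norm (a n))\<^sup>2)"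
proof -
  define b where "b = (\<Sum>n\<in>S. w n *\<^sub>R a n)"
  have "0 \<le> (\<Sum>n\<in>S. w n * (norm (a n - b))\<^sup>2)"
    using assms(1) by (intro sum_nonneg) auto
  also have "\<dots> = (\<Sum>n\<in>S. w n * (norm (a n))\<^sup>2 - 2 * ((w n *\<^sub>R a n) \<bullet> b) + w n * (norm b)\<^sup>2)"
    by (intro sum.cong) (auto simp: power2_norm_eq_inner inner_diff inner_commute algebra_simps)
  also have "\<dots> = (\<Sum>n\<in>S. w n * (norm (a n))\<^sup>2) - 2 * (b \<bullet> b) + (norm b)\<^sup>2"
    using assms(2) unfolding sum.distrib sum_subtractf
    by (simp add: b_def inner_sum_left sum_distrib_left[symmetric] sum_distrib_right[symmetric])
  finally show ?thesis
    by (simp add: b_def[symmetric] power2_norm_eq_inner)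
qed

text \<open>
  Here \<open>D\<close> is \<open>\<parallel>T x - x\<parallel>\<^sup>2\<close>, \<open>E\<close> the weighted sum in the numerator of \<open>\<tau>\<close>, \<open>F\<close> the part
  of \<open>E\<close> made of moves inside the strings, \<open>\<mu>\<close> the maximal string length, \<open>\<alpha>\<close> the relaxation
  parameter and \<open>\<sigma>\<close> the extrapolation factor.  The definition of \<open>\<tau>\<close> expresses \<open>E\<close> and \<open>D\<close>
  through one another.  Keeping \<open>D\<close> on the right gives the first bound; keeping \<open>E\<close> and
  using \<open>F \<le> E - D\<close> gives the second, whose factor in front of \<open>F\<close> is exactly the quotient of
  the right-hand side by \<open>E - D\<close>.
\<close>

lemma extrapolated_step_real_bounds:
  fixes D E F \<tau> \<sigma> \<alpha> \<mu> \<rho> :: real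
  assumes D: "D > 0" and \<mu>: "\<mu> > 0" and \<tau>: "\<tau> = \<mu> / (\<mu> + 1) * E / D"
    and \<sigma>: "1 \<le> \<sigma>" "\<sigma> \<le> \<tau>" and \<alpha>: "\<alpha> > 0" "\<mu> * \<alpha> \<le> \<mu> + 1" and F: "D + F \<le> E"
    and \<rho>: "\<alpha> * (1 + \<rho>) \<le> 1 + 1 / \<mu>"
  shows "\<rho> * ((\<alpha> * \<sigma>)\<^sup>2 * D) \<le> \<alpha> * \<sigma> * E - (\<alpha> * \<sigma>)\<^sup>2 * D"
    and "\<alpha> * \<sigma> * ((1 + \<mu> - \<mu> * \<alpha> * (\<sigma> / \<tau>)) / (1 + \<mu> - \<mu> / \<tau>)) * F
           \<le> \<alpha> * \<sigma> * E - (\<alpha> * \<sigma>)\<^sup>2 * D"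
proof -
  have E: "E = (1 + 1 / \<mu>) * \<tau> * D"
    using D \<mu> by (simp add: \<tau> divide_simps)
  have \<tau>1: "\<tau> \<ge> 1" using \<sigma> by linarith
  have "(\<alpha> * (1 + \<rho>)) * \<sigma> \<le> (1 + 1 / \<mu>) * \<sigma>"
    using \<rho> \<sigma> by (intro mult_right_mono) auto
  also have "\<dots> \<le> (1 + 1 / \<mu>) * \<tau>"
    using \<mu> \<sigma> by (intro mult_left_mono) auto
  finally have "(\<alpha> * \<sigma> * D) * ((\<alpha> * (1 + \<rho>)) * \<sigma>) \<le> (\<alpha> * \<sigma> * D) * ((1 + 1 / \<mu>) * \<tau>)"
    using \<alpha> \<sigma> D by (intro mult_left_mono) auto
  then show "\<rho> * ((\<alpha> * \<sigma>)\<^sup>2 * D) \<le> \<alpha> * \<sigma> * E - (\<alpha> * \<sigma>)\<^sup>2 * D"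
    by (simp add: E power2_eq_square algebra_simps)
  define P where "P = 1 + \<mu> - \<mu> * \<alpha> * (\<sigma> / \<tau>)"
  define R where "R = 1 + \<mu> - \<mu> / \<tau>"
  have R: "R > 0"
    using \<mu> \<tau>1 by (simp add: R_def field_simps add_strict_increasing)
  have P: "P \<ge> 0"
  proof -
    have "\<mu> * \<alpha> * (\<sigma> / \<tau>) \<le> (\<mu> * \<alpha>) * 1"
      using \<mu> \<alpha> \<sigma> by (intro mult_left_mono) auto
    then show ?thesis using \<alpha> by (simp add: P_def)
  qed
  have E': "E = (1 + \<mu>) * (\<tau> * D / \<mu>)"
    using \<mu> by (simp add: E field_simps)
  have \<tau>R: "\<tau> * R = \<tau> * (1 + \<mu>) - \<mu>" and \<tau>P: "\<tau> * P = \<tau> * (1 + \<mu>) - \<mu> * \<alpha> * \<sigma>"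
    using \<tau>1 by (simp_all add: R_def P_def right_diff_distrib)
  have "E * R / (1 + \<mu>) = (\<tau> * R) * D / \<mu>"
    using \<mu> by (simp add: E')
  also have "\<dots> = E - D"
    unfolding \<tau>R using \<mu> by (simp add: E' field_simps)
  finally have ED: "E - D = E * R / (1 + \<mu>)" by simp
  have "E * P / (1 + \<mu>) = (\<tau> * P) * D / \<mu>"
    using \<mu> by (simp add: E')
  also have "\<dots> = E - \<alpha> * \<sigma> * D"
    unfolding \<tau>P using \<mu> by (simp add: E' field_simps)
  finally have EP: "\<alpha> * \<sigma> * E - (\<alpha> * \<sigma>)\<^sup>2 * D = \<alpha> * \<sigma> * (E * P / (1 + \<mu>))"
    by (simp add: power2_eq_square right_diff_distrib mult_ac)
  have "\<alpha> * \<sigma> * (P / R) * F \<le> \<alpha> * \<sigma> * (P / R) * (E - D)"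
    using F P R \<alpha> \<sigma> by (intro mult_left_mono) auto
  also have "\<dots> = \<alpha> * \<sigma> * E - (\<alpha> * \<sigma>)\<^sup>2 * D"
    unfolding ED EP using R by simp
  finally show "\<alpha> * \<sigma> * ((1 + \<mu> - \<mu> * \<alpha> * (\<sigma> / \<tau>)) / (1 + \<mu> - \<mu> / \<tau>)) * F
           \<le> \<alpha> * \<sigma> * E - (\<alpha> * \<sigma>)\<^sup>2 * D"
    by (simp only: P_def R_def)
qed

locale string_averaging =
  fixes U :: "'i \<Rightarrow> 'a::real_inner \<Rightarrow> 'a" and N :: nat and w :: "nat \<Rightarrow> real" and J :: "nat \<Rightarrow> 'i list"
  assumes cutters: "i \<in> active_indices N J \<Longrightarrow> cutter (U i)"
    and nonempty: "n \<in> {1..N} \<Longrightarrow> J n \<noteq> []"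
    and w_pos: "n \<in> {1..N} \<Longrightarrow> 0 < w n"
    and w_sum: "(\<Sum>n=1..N. w n) = 1"
begin

abbreviation "Q n \<equiv> string_product U (J n)"
abbreviation "T \<equiv> string_average U N w J"
abbreviation "\<tau> \<equiv> extrapolation_bound U N w J"
abbreviation "\<mu> \<equiv> real (max_string_length N J)"
abbreviation "common_Fix \<equiv> \<Inter>i\<in>active_indices N J. Fix (U i)"
abbreviation "energy x \<equiv> \<Sum>n=1..N. w n * string_energy U (J n) x"
abbreviation "total_energy x \<equiv> \<Sum>n=1..N. w n * ((norm (Q n x - x))\<^sup>2 + string_energy U (J n) x)"

lemma N_pos: "N \<ge> 1"
  using w_sum by (cases "N = 0") auto

lemma length_le_max: "n \<in> {1..N} \<Longrightarrow> length (J n) \<le> max_string_length N J"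
  unfolding max_string_length_def by (intro Max_ge) auto

lemma max_pos: "\<mu> \<ge> 1"
proof -
  have "1 \<le> length (J 1)"
    using nonempty[of 1] N_pos by (simp add: Suc_le_eq)
  also have "\<dots> \<le> max_string_length N J"
    using length_le_max[of 1] N_pos by simp
  finally show ?thesis by simp
qed

lemma energy_nonneg: "0 \<le> energy x"
  using w_pos by (intro sum_nonneg mult_nonneg_nonneg string_energy_nonneg less_imp_le) auto

lemma average_displacement: "T x - x = (\<Sum>n=1..N. w n *\<^sub>R (Q n x - x))"
  by (simp add: string_average_def scaleR_diff_right sum_subtractf w_sum[simplified] flip: scaleR_left.sum)

lemma cutter_in: "n \<in> {1..N} \<Longrightarrow> i \<in> set (J n) \<Longrightarrow> cutter (U i)"
  by (rule cutters) (auto simp: active_indices_def)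

lemma Fix_in: "z \<in> common_Fix \<Longrightarrow> n \<in> {1..N} \<Longrightarrow> i \<in> set (J n) \<Longrightarrow> z \<in> Fix (U i)"
  by (auto simp: active_indices_def)

text \<open>
  For each string, expanding \<open>\<parallel>Q n x - z\<parallel>\<^sup>2\<close> about \<open>x\<close> in \<open>string_norm_square_le\<close> leaves an
  inner product linear in \<open>Q n x - x\<close>, and linear estimates can be averaged.  Up to the factor
  \<open>\<mu> / (\<mu> + 1)\<close> the left-hand side is the numerator of \<open>\<tau> x\<close>.
\<close>

lemma total_le_inner:
  assumes "z \<in> common_Fix"
  shows "total_energy x \<le> 2 * ((T x - x) \<bullet> (z - x))"
proof -
  have "total_energy x \<le> (\<Sum>n=1..N. w n * (2 * ((Q n x - x) \<bullet> (z - x))))"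
  proof (intro sum_mono mult_left_mono)
    fix n assume n: "n \<in> {1..N}"
    have "(norm (Q n x - z))\<^sup>2 = (norm (x - z))\<^sup>2 - 2 * ((Q n x - x) \<bullet> (z - x)) + (norm (Q n x - x))\<^sup>2"
      by (simp add: power2_norm_eq_inner inner_diff inner_commute)
    then show "(norm (Q n x - x))\<^sup>2 + string_energy U (J n) x \<le> 2 * ((Q n x - x) \<bullet> (z - x))"
      using string_norm_square_le[of "J n" U z x] cutter_in[OF n] Fix_in[OF assms n] by simp
    show "0 \<le> w n" using w_pos[OF n] by simp
  qed
  also have "\<dots> = 2 * ((T x - x) \<bullet> (z - x))"
    unfolding average_displacement by (simp add: inner_sum_left sum_distrib_left mult_ac)
  finally show ?thesis .
qed

lemma displacement_plus_energy_le_total: "(norm (T x - x))\<^sup>2 + energy x \<le> total_energy x"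
proof -
  have "(norm (T x - x))\<^sup>2 \<le> (\<Sum>n=1..N. w n * (norm (Q n x - x))\<^sup>2)"
    unfolding average_displacement using w_pos w_sum
    by (intro norm_square_weighted_mean_le) (auto simp: less_imp_le)
  then show ?thesis
    by (simp add: distrib_left sum.distrib)
qed

lemma total_eq_0: "x \<in> common_Fix \<Longrightarrow> total_energy x = 0"
proof -
  assume "x \<in> common_Fix"
  from total_le_inner[OF this, of x] have "total_energy x \<le> 0" by simp
  moreover have "0 \<le> total_energy x"
    by (intro sum_nonneg mult_nonneg_nonneg add_nonneg_nonneg string_energy_nonneg zero_le_power2
        less_imp_le[OF w_pos])
  ultimately show ?thesis by simp
qed

text \<open>
  If \<open>x\<close> is already a common fixed point, the step does not move and there is nothing to show.
  Otherwise \<open>1 \<le> \<tau> x\<close> excludes \<open>T x = x\<close>, since division by zero would make \<open>\<tau> x\<close> zero.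
\<close>

lemma extrapolated_step:
  assumes z: "z \<in> common_Fix" and \<sigma>: "1 \<le> \<sigma>" "\<sigma> \<le> \<tau> x" and \<alpha>: "\<alpha> > 0" "\<mu> * \<alpha> \<le> \<mu> + 1"
    and \<rho>: "\<alpha> * (1 + \<rho>) \<le> 1 + 1 / \<mu>" and x': "x' = x + (\<alpha> * \<sigma>) *\<^sub>R (T x - x)"
  shows "\<rho> * (norm (x' - x))\<^sup>2 \<le> (norm (x - z))\<^sup>2 - (norm (x' - z))\<^sup>2"
    and "\<alpha> * \<sigma> * ((1 + \<mu> - \<mu> * \<alpha> * (\<sigma> / \<tau> x)) / (1 + \<mu> - \<mu> / \<tau> x)) * energy x
           \<le> (norm (x - z))\<^sup>2 - (norm (x' - z))\<^sup>2"
proof -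
  define D where "D = (norm (T x - x))\<^sup>2"
  have disp: "(norm (x' - x))\<^sup>2 = (\<alpha> * \<sigma>)\<^sup>2 * D"
    by (simp add: x' D_def power_mult_distrib)
  have flip: "(x - z) \<bullet> (T x - x) = - ((T x - x) \<bullet> (z - x))"
    by (simp add: inner_diff inner_commute)
  have "x' - z = (x - z) + (\<alpha> * \<sigma>) *\<^sub>R (T x - x)"
    by (simp add: x')
  then have "(norm (x' - z))\<^sup>2
      = (norm (x - z))\<^sup>2 + 2 * ((x - z) \<bullet> ((\<alpha> * \<sigma>) *\<^sub>R (T x - x))) + (\<alpha> * \<sigma>)\<^sup>2 * D"
    by (simp only: power2_norm_eq_inner[of "_ + _"] inner_add_left inner_add_right)
      (simp add: D_def inner_commute dot_square_norm power2_eq_square)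
  then have "(norm (x - z))\<^sup>2 - (norm (x' - z))\<^sup>2 = \<alpha> * \<sigma> * (2 * ((T x - x) \<bullet> (z - x))) - (\<alpha> * \<sigma>)\<^sup>2 * D"
    using flip by simp
  moreover have "\<alpha> * \<sigma> * total_energy x \<le> \<alpha> * \<sigma> * (2 * ((T x - x) \<bullet> (z - x)))"
    using total_le_inner[OF z, of x] \<alpha> \<sigma> by (intro mult_left_mono) auto
  ultimately have dec: "\<alpha> * \<sigma> * total_energy x - (\<alpha> * \<sigma>)\<^sup>2 * D \<le> (norm (x - z))\<^sup>2 - (norm (x' - z))\<^sup>2"
    by linarith
  have *: "\<rho> * (norm (x' - x))\<^sup>2 \<le> (norm (x - z))\<^sup>2 - (norm (x' - z))\<^sup>2 \<and>
     \<alpha> * \<sigma> * ((1 + \<mu> - \<mu> * \<alpha> * (\<sigma> / \<tau> x)) / (1 + \<mu> - \<mu> / \<tau> x)) * energy x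
           \<le> (norm (x - z))\<^sup>2 - (norm (x' - z))\<^sup>2"
  proof (cases "x \<in> common_Fix")
    case True
    then have "D + energy x \<le> 0"
      using displacement_plus_energy_le_total[of x] total_eq_0[of x] by (simp add: D_def)
    moreover have "0 \<le> D" by (simp add: D_def)
    ultimately have "D = 0" "energy x = 0"
      using energy_nonneg[of x] by linarith+
    then show ?thesis
      using dec total_eq_0[OF True] disp by simp
  next
    case False
    then have \<tau>: "\<tau> x = \<mu> / (\<mu> + 1) * total_energy x / D"
      by (simp add: extrapolation_bound_def string_energy_def D_def)
    then have "D \<noteq> 0" using \<sigma> by auto
    then have "D > 0" by (simp add: D_def)
    from extrapolated_step_real_bounds[OF this _ \<tau> \<sigma> \<alpha> displacement_plus_energy_le_total[of x, folded D_def] \<rho>]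
    show ?thesis
      using max_pos dec unfolding disp by linarith
  qed
  show "\<rho> * (norm (x' - x))\<^sup>2 \<le> (norm (x - z))\<^sup>2 - (norm (x' - z))\<^sup>2" using * ..
  show "\<alpha> * \<sigma> * ((1 + \<mu> - \<mu> * \<alpha> * (\<sigma> / \<tau> x)) / (1 + \<mu> - \<mu> / \<tau> x)) * energy x
           \<le> (norm (x - z))\<^sup>2 - (norm (x' - z))\<^sup>2" using * ..
qed

text \<open>
  The string through \<open>i\<close> has weight at least \<open>\<omega>\<close> and length at most \<open>\<mu>\<close>; the other strings
  only add to the energy.
\<close>

lemma step_passes_near_active_index:
  assumes i: "i \<in> active_indices N J" and \<omega>: "\<omega> > 0" "\<And>n. n \<in> {1..N} \<Longrightarrow> \<omega> \<le> w n"
  obtains u where "\<omega> * (norm (u - x) + norm (U i u - u))\<^sup>2 \<le> \<mu> * energy x"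
    and "\<And>z. z \<in> common_Fix \<Longrightarrow> norm (u - z) \<le> norm (x - z)"
proof -
  obtain n where n: "n \<in> {1..N}" "i \<in> set (J n)"
    using i by (auto simp: active_indices_def)
  obtain l where l: "l \<le> length (J n)"
    "(norm (string_product U (take l (J n)) x - x)
      + norm (U i (string_product U (take l (J n)) x) - string_product U (take l (J n)) x))\<^sup>2
      \<le> real (length (J n)) * string_energy U (J n) x" (is "?d\<^sup>2 \<le> _")
    using string_passes_near_every_index[OF n(2)] by blast
  have "\<omega> * ?d\<^sup>2 \<le> w n * (\<mu> * string_energy U (J n) x)"
  proof (rule mult_mono)
    show "?d\<^sup>2 \<le> \<mu> * string_energy U (J n) x"
      using length_le_max[OF n(1)]
      by (intro order_trans[OF l(2)] mult_right_mono string_energy_nonneg) simp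
  qed (use \<omega>(2) w_pos n(1) in \<open>auto simp: less_imp_le\<close>)
  also have "\<dots> = \<mu> * (w n * string_energy U (J n) x)" by simp
  also have "\<dots> \<le> \<mu> * energy x"
    using n(1) w_pos
    by (intro mult_left_mono member_le_sum mult_nonneg_nonneg string_energy_nonneg)
      (auto simp: less_imp_le)
  finally have 1: "\<omega> * ?d\<^sup>2 \<le> \<mu> * energy x" .
  have 2: "norm (string_product U (take l (J n)) x - z) \<le> norm (x - z)" if z: "z \<in> common_Fix" for z
  proof -
    have "(norm (string_product U (take l (J n)) x - z))\<^sup>2
       + (\<Sum>p=1..l. (norm (string_product U (take p (J n)) x - string_product U (take (p - 1) (J n)) x))\<^sup>2)
       \<le> (norm (x - z))\<^sup>2"
      using string_partial_norm_square_le[OF cutter_in[OF n(1)] Fix_in[OF z n(1)] l(1)] .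
    then have "(norm (string_product U (take l (J n)) x - z))\<^sup>2 \<le> (norm (x - z))\<^sup>2"
      by (rule order_trans[rotated]) (simp add: sum_nonneg)
    then show ?thesis by (simp add: power2_le_iff_abs_le)
  qed
  show thesis using that[OF 1 2] .
qed

end

section \<open>Convergence under intermittent control\<close>

text \<open>
  The distance shrinks by the factor \<open>q ^ s\<close>, with \<open>q = root (2 * s) b\<close>, every \<open>s\<close> indices.  For
  \<open>k < s\<close> the exponent is at most \<open>0\<close>, so the bound follows from \<open>d k \<le> d 0\<close>, provided that the
  base does not vanish; for \<open>s = 1\<close> the only such index is \<open>k = 0\<close>, with exponent \<open>0\<close>, and
  the base may be \<open>0\<close>.
\<close>

lemma geometric_decay_root:
  fixes d :: "nat \<Rightarrow> real"
  assumes s: "s \<ge> 1" and nonneg: "\<And>k. 0 \<le> d k" and mono: "\<And>k. d k \<le> d 0"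
    and decay: "\<And>k. (d (k + s))\<^sup>2 \<le> b * (d k)\<^sup>2" and b: "0 \<le> b" "b \<le> 1" "b > 0 \<or> s = 1"
  shows "d k \<le> d 0 * root (2 * s) b powi (int k - int s + 1)"
proof -
  define q where "q = root (2 * s) b"
  have q: "0 \<le> q" "q \<le> 1" "q ^ (2 * s) = b"
    using s b by (auto simp: q_def real_root_le_1_iff)
  have step: "d (k + s) \<le> q ^ s * d k" for k
  proof (rule power2_le_imp_le)
    show "(d (k + s))\<^sup>2 \<le> (q ^ s * d k)\<^sup>2"
      using decay[of k] q(3) by (simp add: power_mult_distrib power_mult[symmetric] mult.commute)
  qed (use nonneg q(1) in auto)
  show ?thesis
    unfolding q_def[symmetric]
  proof (cases "q = 0")
    case True
    then have "s = 1" using b q(3) s by (auto simp: zero_power)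
    then show "d k \<le> d 0 * q powi (int k - int s + 1)"
      using step[of "k - 1"] True by (cases k) auto
  next
    case False
    with q have q0: "0 < q" by simp
    show "d k \<le> d 0 * q powi (int k - int s + 1)"
    proof (induction k rule: less_induct)
      case (less k)
      show ?case
      proof (cases "k < s")
        case True
        then have "1 \<le> q powi (int k - int s + 1)"
          using q0 q(2) by (auto simp: power_int_def one_le_inverse_iff power_le_one power_inverse)
        then show ?thesis
          using mono[of k] mult_left_mono[OF _ nonneg[of 0], of 1] by (metis mult_1_right order_trans)
      next
        case False
        then have k: "k - s + s = k" "k - s < k" using s by auto
        have "d k \<le> q ^ s * d (k - s)"
          using step[of "k - s"] k(1) by simp
        also have "\<dots> \<le> q ^ s * (d 0 * q powi (int (k - s) - int s + 1))"
          using less.IH[OF k(2)] q0 by (intro mult_left_mono) auto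
        also have "\<dots> = d 0 * (q powi int s * q powi (int (k - s) - int s + 1))"
          by simp
        also have "q powi int s * q powi (int (k - s) - int s + 1) = q powi (int s + (int (k - s) - int s + 1))"
          using q0 by (subst power_int_add) auto
        also have "int s + (int (k - s) - int s + 1) = int k - int s + 1"
          using False by simp
        finally show ?thesis .
      qed
    qed
  qed
qed

text \<open>
  What the convergence proofs use of the iteration.  Both the displacement of a step and, for
  each active index, the detour from \<open>x k\<close> to a point \<open>u\<close> together with the displacement of
  \<open>U i\<close> at \<open>u\<close> are paid for by the decrease of the squared distance to any common fixed point.
  The point \<open>u\<close> is no farther than \<open>x k\<close> from any point of \<open>C\<close>, which keeps it in \<open>B\<close>, where the
  regularity assumptions apply.
\<close>

locale fejer_sweep =
  fixes U :: "'i \<Rightarrow> 'a::{real_inner, banach} \<Rightarrow> 'a" and I :: "'i set" and C B :: "'a set"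
    and x :: "nat \<Rightarrow> 'a" and s :: nat and Ik :: "nat \<Rightarrow> 'i set" and \<rho> K r :: real and c :: 'a
  assumes I: "finite I" "I \<noteq> {}"
    and cutters: "i \<in> I \<Longrightarrow> cutter (U i)"
    and C: "C = (\<Inter>i\<in>I. Fix (U i))" and c: "c \<in> C" and B: "B = cball c r" "x 0 \<in> B"
    and control: "intermittent_control s I Ik"
    and pos: "\<rho> > 0" "K > 0"
    and displacement: "z \<in> C \<Longrightarrow>
      \<rho> * (norm (x (Suc k) - x k))\<^sup>2 \<le> (norm (x k - z))\<^sup>2 - (norm (x (Suc k) - z))\<^sup>2"
    and witness: "i \<in> Ik k \<Longrightarrow> \<exists>u. (\<forall>z\<in>C. norm (u - z) \<le> norm (x k - z)) \<and>
      (\<forall>z\<in>C. (norm (u - x k) + norm (U i u - u))\<^sup>2 \<le> K * ((norm (x k - z))\<^sup>2 - (norm (x (Suc k) - z))\<^sup>2))"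
begin

lemma C_ne: "C \<noteq> {}"
  using c by blast

lemma C_closed: "closed C" and C_convex: "convex C"
  unfolding C using cutters by (auto intro: closed_Fix_cutter convex_Fix_cutter convex_INT)

lemma C_in_Fix: "z \<in> C \<Longrightarrow> i \<in> I \<Longrightarrow> z \<in> Fix (U i)"
  by (simp add: C)

lemma s_pos: "s \<ge> 1"
  using control by (simp add: intermittent_control_def)

lemma fejer: "fejer_monotone C x"
  unfolding fejer_monotone_def
proof (intro ballI decseq_SucI)
  fix z k assume "z \<in> C"
  have "0 \<le> \<rho> * (norm (x (Suc k) - x k))\<^sup>2"
    using pos(1) by simp
  then have "(norm (x (Suc k) - z))\<^sup>2 \<le> (norm (x k - z))\<^sup>2"
    using displacement[OF \<open>z \<in> C\<close>, of k] by linarith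
  then show "norm (x (Suc k) - z) \<le> norm (x k - z)"
    by (simp add: power2_le_iff_abs_le)
qed

lemma in_B: "norm (u - c) \<le> norm (x k - c) \<Longrightarrow> u \<in> B"
  using fejer_monotoneD[OF fejer c, of 0 k] B by (simp add: dist_norm norm_minus_commute)

lemma iterate_in_B: "x k \<in> B"
  by (rule in_B[of _ k]) simp

text \<open>
  Let \<open>k + j\<close> be a step at which \<open>i\<close> is active.  Reaching \<open>u\<close> from \<open>x k\<close> takes the steps
  \<open>k, \<dots>, k + j - 1\<close> and then the detour inside step \<open>k + j\<close>.  Each of these has length at
  most \<open>sqrt (L * A t)\<close>, where \<open>A t\<close> is the decrease achieved by its own step, so no decrease is used
  twice.  There are at most \<open>s\<close> terms, and the Cauchy-Schwarz inequality gives the factor \<open>s\<close>.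
  The parameter \<open>\<delta>\<close> is the linear regularity constant; the convergence without a rate takes
  \<open>\<delta> = 1\<close>.
\<close>

lemma near_almost_fixed_point:
  assumes i: "i \<in> I" and z: "z \<in> C" and \<delta>: "0 < \<delta>" "\<delta> \<le> 1" and L: "1 / \<rho> \<le> L" "K / \<delta>\<^sup>2 \<le> L"
  obtains u where "u \<in> B"
    "(norm (u - x k) + norm (U i u - u) / \<delta>)\<^sup>2 \<le> real s * L * ((norm (x k - z))\<^sup>2 - (norm (x (k + s) - z))\<^sup>2)"
proof -
  define A where "A t = (norm (x (k + t) - z))\<^sup>2 - (norm (x (k + Suc t) - z))\<^sup>2" for t
  have A: "0 \<le> A t" for t
    using fejer_monotoneD[OF fejer z, of "k + t" "k + Suc t"] by (simp add: A_def power_mono)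
  have "0 < 1 / \<rho>" using pos(1) by simp
  then have L0: "0 < L" using L(1) by linarith
  have move: "norm (x (k + Suc t) - x (k + t)) \<le> sqrt (L * A t)" for t
  proof (rule real_le_rsqrt)
    have "(norm (x (k + Suc t) - x (k + t)))\<^sup>2 \<le> 1 / \<rho> * A t"
      using displacement[OF z, of "k + t"] pos(1) by (simp add: A_def field_simps)
    also have "\<dots> \<le> L * A t"
      using L(1) A by (rule mult_right_mono)
    finally show "(norm (x (k + Suc t) - x (k + t)))\<^sup>2 \<le> L * A t" .
  qed
  have travel: "norm (x (k + j) - x k) \<le> (\<Sum>t<j. sqrt (L * A t))" for j
  proof -
    have "x (k + j) - x k = (\<Sum>t<j. x (k + Suc t) - x (k + t))"
      by (subst sum_lessThan_telescope) simp
    also have "norm \<dots> \<le> (\<Sum>t<j. sqrt (L * A t))"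
      using move by (rule sum_norm_le)
    finally show ?thesis .
  qed
  have "i \<in> (\<Union>j\<in>{k..k + s - 1}. Ik j)"
    using control i by (auto simp: intermittent_control_def)
  then obtain l where l: "k \<le> l" "l \<le> k + s - 1" "i \<in> Ik l"
    by auto
  define j where "j = l - k"
  have j: "j < s" "i \<in> Ik (k + j)"
    using l s_pos by (auto simp: j_def)
  obtain u where u: "\<And>v. v \<in> C \<Longrightarrow> norm (u - v) \<le> norm (x (k + j) - v)"
      "(norm (u - x (k + j)) + norm (U i u - u))\<^sup>2 \<le> K * A j"
    using witness[OF j(2)] z by (auto simp: A_def)
  define e where "e = norm (u - x (k + j)) + norm (U i u - u)"
  have "norm (u - x (k + j)) \<le> norm (u - x (k + j)) / \<delta>"
    using \<delta> by (simp add: le_divide_eq mult_right_le_one_le)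
  then have "norm (u - x (k + j)) + norm (U i u - u) / \<delta> \<le> e / \<delta>"
    by (simp add: e_def add_divide_distrib)
  also have "\<dots> \<le> sqrt (L * A j)"
  proof (rule real_le_rsqrt)
    have "(e / \<delta>)\<^sup>2 \<le> K / \<delta>\<^sup>2 * A j"
      using u(2) \<delta>(1) by (simp add: e_def[symmetric] power_divide divide_right_mono)
    also have "\<dots> \<le> L * A j"
      using L(2) A by (rule mult_right_mono)
    finally show "(e / \<delta>)\<^sup>2 \<le> L * A j" .
  qed
  finally have "norm (u - x k) + norm (U i u - u) / \<delta> \<le> (\<Sum>t<Suc j. sqrt (L * A t))"
    using travel[of j] norm_triangle_ineq[of "u - x (k + j)" "x (k + j) - x k"] by simp
  also have "\<dots> \<le> (\<Sum>t<s. sqrt (L * A t))"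
    using j(1) A L0 by (intro sum_mono2) auto
  finally have "(norm (u - x k) + norm (U i u - u) / \<delta>)\<^sup>2 \<le> (\<Sum>t<s. sqrt (L * A t))\<^sup>2"
    using \<delta>(1) by (intro power_mono add_nonneg_nonneg) auto
  also have "\<dots> \<le> (\<Sum>t<s. (sqrt (L * A t))\<^sup>2) * real s"
    using sum_squared_le_sum_of_squares[of "\<lambda>t. sqrt (L * A t)" "{..<s}"] by simp
  also have "(\<Sum>t<s. (sqrt (L * A t))\<^sup>2) = L * (\<Sum>t<s. A t)"
    using A L0 by (simp add: sum_distrib_left)
  also have "(\<Sum>t<s. A t) = (norm (x k - z))\<^sup>2 - (norm (x (k + s) - z))\<^sup>2"
    unfolding A_def by (subst sum_lessThan_telescope') simp
  finally have "(norm (u - x k) + norm (U i u - u) / \<delta>)\<^sup>2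
      \<le> real s * L * ((norm (x k - z))\<^sup>2 - (norm (x (k + s) - z))\<^sup>2)"
    by (simp add: mult_ac)
  moreover have "u \<in> B"
    using in_B u(1)[OF c] .
  ultimately show thesis using that by blast
qed

lemma vanishing_almost_fixed_points:
  assumes i: "i \<in> I"
  obtains u where "range u \<subseteq> B" "(\<lambda>k. u k - x k) \<longlonglongrightarrow> 0" "(\<lambda>k. U i (u k) - u k) \<longlonglongrightarrow> 0"
proof -
  define L where "L = max (1 / \<rho>) K"
  define g where "g k = (norm (x k - c))\<^sup>2" for k
  define e where "e k = sqrt (real s * L * (g k - g (k + s)))" for k
  have "\<exists>u. u \<in> B \<and> (norm (u - x k) + norm (U i u - u))\<^sup>2 \<le> real s * L * (g k - g (k + s))" for k
    using near_almost_fixed_point[OF i c, of 1 L k] by (auto simp: L_def g_def)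
  then obtain u where u: "\<And>k. u k \<in> B"
    "\<And>k. (norm (u k - x k) + norm (U i (u k) - u k))\<^sup>2 \<le> real s * L * (g k - g (k + s))"
    by metis
  have le: "norm (u k - x k) + norm (U i (u k) - u k) \<le> e k" for k
    unfolding e_def using u(2) by (rule real_le_rsqrt)
  obtain l where l: "(\<lambda>k. norm (x k - c)) \<longlonglongrightarrow> l"
    using fejer_convergent[OF fejer c] by (auto simp: convergent_def)
  then have gl: "g \<longlonglongrightarrow> l\<^sup>2"
    unfolding g_def by (intro tendsto_intros)
  have "e \<longlonglongrightarrow> sqrt (real s * L * (l\<^sup>2 - l\<^sup>2))"
    unfolding e_def by (intro tendsto_intros gl LIMSEQ_ignore_initial_segment)
  then have e0: "e \<longlonglongrightarrow> 0" by simp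
  show thesis
  proof
    show "range u \<subseteq> B" using u(1) by blast
    have "norm (u k - x k) \<le> e k" "norm (U i (u k) - u k) \<le> e k" for k
      using le[of k] norm_ge_zero[of "u k - x k"] norm_ge_zero[of "U i (u k) - u k"] by linarith+
    then show "(\<lambda>k. u k - x k) \<longlonglongrightarrow> 0" "(\<lambda>k. U i (u k) - u k) \<longlonglongrightarrow> 0"
      by (auto intro!: Lim_null_comparison[OF _ e0])
  qed
qed

text \<open>
  The auxiliary points \<open>u\<close> of an index \<open>i\<close> share the weak cluster points of \<open>x\<close>, since
  \<open>u k - x k\<close> tends to \<open>0\<close>; weak regularity of \<open>U i\<close> is applied to them and not to \<open>x\<close>.
\<close>

theorem weak_convergence:
  assumes reg: "\<And>i. i \<in> I \<Longrightarrow> weakly_regular_over (U i) B"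
  obtains z where "z \<in> C \<inter> B" "weakly_converges x z"
proof -
  have "z \<in> C" if f: "strict_mono f" "weakly_converges (x \<circ> f) z" for f z
    unfolding C
  proof
    fix i assume i: "i \<in> I"
    obtain u where u: "range u \<subseteq> B" "(\<lambda>k. u k - x k) \<longlonglongrightarrow> 0" "(\<lambda>k. U i (u k) - u k) \<longlonglongrightarrow> 0"
      using vanishing_almost_fixed_points[OF i] .
    have "weakly_converges (u \<circ> f) z"
      unfolding weakly_converges_def
    proof
      fix y
      have "(\<lambda>k. (u k - x k) \<bullet> y) \<longlonglongrightarrow> 0 \<bullet> y"
        using u(2) by (intro tendsto_intros)
      from LIMSEQ_subseq_LIMSEQ[OF this f(1)]
      have "(\<lambda>k. (u (f k) - x (f k)) \<bullet> y) \<longlonglongrightarrow> 0"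
        by (simp add: o_def)
      moreover have "(\<lambda>k. x (f k) \<bullet> y) \<longlonglongrightarrow> z \<bullet> y"
        using f(2) by (simp add: weakly_converges_def)
      ultimately show "(\<lambda>k. (u \<circ> f) k \<bullet> y) \<longlonglongrightarrow> z \<bullet> y"
        using tendsto_add by (fastforce simp: inner_diff_left)
    qed
    moreover have "(\<lambda>k. U i ((u \<circ> f) k) - (u \<circ> f) k) \<longlonglongrightarrow> 0"
      using LIMSEQ_subseq_LIMSEQ[OF u(3) f(1)] by (simp add: o_def)
    moreover have "range (u \<circ> f) \<subseteq> B"
      using u(1) by auto
    ultimately show "z \<in> Fix (U i)"
      using reg[OF i] unfolding weakly_regular_over_def by blast
  qed
  then obtain z where z: "z \<in> C" "weakly_converges x z"
    using fejer_weakly_converges[OF fejer C_ne] by blast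
  moreover have "z \<in> B"
    using weak_limit_in_cball[OF z(2)] iterate_in_B unfolding B by blast
  ultimately show thesis using that by blast
qed

lemma strong_convergence_from_infdist:
  assumes "(\<lambda>k. infdist (x k) C) \<longlonglongrightarrow> 0"
  obtains z where "z \<in> C \<inter> B" "x \<longlonglongrightarrow> z" "\<And>k. norm (x k - z) \<le> 2 * infdist (x k) C"
proof -
  obtain z where z: "z \<in> C" "x \<longlonglongrightarrow> z" "\<And>k. norm (x k - z) \<le> 2 * infdist (x k) C"
    using fejer_strongly_converges[OF fejer C_closed C_ne assms] by blast
  have "closed B"
    by (simp add: B)
  then have "z \<in> B"
    using closed_sequentially[of B x z] iterate_in_B z(2) by blast
  with z that show thesis by blast
qed

theorem strong_convergence:
  assumes reg: "\<And>i. i \<in> I \<Longrightarrow> regular_over (U i) B"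
    and fam: "regular_family_over I (\<lambda>i. Fix (U i)) B"
  obtains z where "z \<in> C \<inter> B" "x \<longlonglongrightarrow> z"
proof -
  have each: "(\<lambda>k. infdist (x k) (Fix (U i))) \<longlonglongrightarrow> 0" if i: "i \<in> I" for i
  proof -
    obtain u where u: "range u \<subseteq> B" "(\<lambda>k. u k - x k) \<longlonglongrightarrow> 0" "(\<lambda>k. U i (u k) - u k) \<longlonglongrightarrow> 0"
      using vanishing_almost_fixed_points[OF i] .
    have "(\<lambda>k. infdist (u k) (Fix (U i))) \<longlonglongrightarrow> 0"
      using reg[OF i] u(1) tendsto_norm_zero[OF u(3)] unfolding regular_over_def by blast
    from tendsto_add[OF this tendsto_norm_zero[OF u(2)]]
    have lim: "(\<lambda>k. infdist (u k) (Fix (U i)) + norm (u k - x k)) \<longlonglongrightarrow> 0"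
      by simp
    have "norm (infdist (x k) (Fix (U i))) \<le> infdist (u k) (Fix (U i)) + norm (u k - x k)" for k
      using infdist_triangle[of "x k" "Fix (U i)" "u k"] infdist_nonneg[of "x k" "Fix (U i)"]
      by (simp add: dist_norm norm_minus_commute)
    then show ?thesis
      by (intro Lim_null_comparison[OF _ lim] always_eventually) blast
  qed
  have "(\<lambda>k. \<Sum>i\<in>I. infdist (x k) (Fix (U i))) \<longlonglongrightarrow> (\<Sum>i\<in>I. 0)"
    using each by (rule tendsto_sum)
  then have lim: "(\<lambda>k. \<Sum>i\<in>I. infdist (x k) (Fix (U i))) \<longlonglongrightarrow> 0"
    by simp
  have "norm (MAX i\<in>I. infdist (x k) (Fix (U i))) \<le> (\<Sum>i\<in>I. infdist (x k) (Fix (U i)))" for k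
  proof -
    have "(MAX i\<in>I. infdist (x k) (Fix (U i))) \<in> (\<lambda>i. infdist (x k) (Fix (U i))) ` I"
      using I by (intro Max_in) auto
    then obtain i where i: "i \<in> I" "(MAX i\<in>I. infdist (x k) (Fix (U i))) = infdist (x k) (Fix (U i))"
      by blast
    then show ?thesis
      using member_le_sum[OF i(1), of "\<lambda>i. infdist (x k) (Fix (U i))"] I infdist_nonneg[of "x k"] by simp
  qed
  then have "(\<lambda>k. MAX i\<in>I. infdist (x k) (Fix (U i))) \<longlonglongrightarrow> 0"
    by (intro Lim_null_comparison[OF _ lim] always_eventually) blast
  then have "(\<lambda>k. infdist (x k) C) \<longlonglongrightarrow> 0"
    using fam iterate_in_B unfolding regular_family_over_def C by blast
  then show thesis
    using strong_convergence_from_infdist that by blast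
qed

lemma cutter_displacement_le_infdist:
  assumes "i \<in> I"
  shows "norm (U i y - y) \<le> infdist y (Fix (U i))"
proof -
  have "Fix (U i) \<noteq> {}"
    using c C_in_Fix assms by blast
  then show ?thesis
    using cutter_displacement_le[OF cutters[OF assms]]
    by (auto simp: infdist_notempty dist_norm intro!: cINF_greatest)
qed

text \<open>
  A cutter moves a point at most by its distance to the fixed points, and each \<open>Fix (U i)\<close>
  contains \<open>C\<close>.  At \<open>x 0\<close>, which lies in \<open>B\<close> but not in \<open>C\<close>, these two inequalities are
  compatible with linear regularity only for such constants.  When \<open>x 0 \<in> C\<close> the constants are
  arbitrary, but then the iteration is stationary.
\<close>

lemma regularity_constants:
  assumes lin: "\<And>i. i \<in> I \<Longrightarrow> linearly_regular_over \<delta> (U i) B"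
    and fam: "linearly_regular_family_over \<kappa> I (\<lambda>i. Fix (U i)) B"
    and x0: "x 0 \<notin> C"
  shows "\<delta> \<le> 1" "\<kappa> \<ge> 1"
proof -
  obtain i where i: "i \<in> I" "x 0 \<notin> Fix (U i)"
    using x0 C by blast
  then have "0 < infdist (x 0) (Fix (U i))"
    using closed_Fix_cutter[OF cutters] c C_in_Fix by (intro infdist_pos_not_in_closed) auto
  moreover have "\<delta> * infdist (x 0) (Fix (U i)) \<le> 1 * infdist (x 0) (Fix (U i))"
    using lin[OF i(1)] B(2) cutter_displacement_le_infdist[OF i(1), of "x 0"]
    by (force simp: linearly_regular_over_def)
  ultimately show "\<delta> \<le> 1"
    by (simp add: mult_le_cancel_right)
  have "0 < infdist (x 0) C"
    using x0 C_closed C_ne by (intro infdist_pos_not_in_closed)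
  moreover have "infdist (x 0) C \<le> \<kappa> * infdist (x 0) C"
  proof -
    have "\<kappa> > 0" and le: "infdist (x 0) C \<le> \<kappa> * (MAX i\<in>I. infdist (x 0) (Fix (U i)))"
      using fam B(2) C by (auto simp: linearly_regular_family_over_def)
    moreover have "(MAX i\<in>I. infdist (x 0) (Fix (U i))) \<le> infdist (x 0) C"
      using I C_in_Fix C_ne by (auto intro!: infdist_mono)
    ultimately show ?thesis
      by (meson order_trans mult_left_mono less_imp_le)
  qed
  ultimately show "\<kappa> \<ge> 1"
    by (simp add: mult_le_cancel_right1)
qed

text \<open>
  With \<open>z\<close> the point of \<open>C\<close> nearest to \<open>x k\<close>, the bound on the distances from \<open>x k\<close> to the
  sets \<open>Fix (U i)\<close> involves
  \<open>\<parallel>x k - z\<parallel>\<^sup>2 - \<parallel>x (k + s) - z\<parallel>\<^sup>2\<close>, which is at most the decrease of the squared distance to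
  \<open>C\<close>.
\<close>

lemma infdist_decay:
  assumes \<delta>: "0 < \<delta>" "\<delta> \<le> 1" and L: "1 / \<rho> \<le> L" "K / \<delta>\<^sup>2 \<le> L"
    and lin: "\<And>i. i \<in> I \<Longrightarrow> linearly_regular_over \<delta> (U i) B"
    and fam: "linearly_regular_family_over \<kappa> I (\<lambda>i. Fix (U i)) B"
  shows "(infdist (x (k + s)) C)\<^sup>2 \<le> (1 - 1 / (real s * \<kappa>\<^sup>2 * L)) * (infdist (x k) C)\<^sup>2"
proof -
  obtain z where z: "z \<in> C" "dist (x k) z = infdist (x k) C"
    using nearest_point_exists[OF C_closed C_convex C_ne] by blast
  define G where "G = real s * L * ((norm (x k - z))\<^sup>2 - (norm (x (k + s) - z))\<^sup>2)"
  have each: "infdist (x k) (Fix (U i)) \<le> sqrt G" if i: "i \<in> I" for i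
  proof -
    obtain u where u: "u \<in> B" "(norm (u - x k) + norm (U i u - u) / \<delta>)\<^sup>2 \<le> G"
      using near_almost_fixed_point[OF i z(1) \<delta> L, of k] unfolding G_def by blast
    have "infdist u (Fix (U i)) \<le> norm (U i u - u) / \<delta>"
      using lin[OF i] u(1) \<delta>(1) by (simp add: linearly_regular_over_def field_simps)
    moreover have "infdist (x k) (Fix (U i)) \<le> infdist u (Fix (U i)) + norm (u - x k)"
      using infdist_triangle[of "x k" "Fix (U i)" u] by (simp add: dist_norm norm_minus_commute)
    ultimately show ?thesis
      using real_le_rsqrt[OF u(2)] by linarith
  qed
  have \<kappa>: "\<kappa> > 0" "infdist (x k) C \<le> \<kappa> * (MAX i\<in>I. infdist (x k) (Fix (U i)))"
    using fam iterate_in_B[of k] C by (auto simp: linearly_regular_family_over_def)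
  have "(MAX i\<in>I. infdist (x k) (Fix (U i))) \<le> sqrt G"
    using I each by auto
  then have "infdist (x k) C \<le> \<kappa> * sqrt G"
    using \<kappa> by (meson order_trans mult_left_mono less_imp_le)
  then have "(infdist (x k) C)\<^sup>2 \<le> (\<kappa> * sqrt G)\<^sup>2"
    by (intro power_mono infdist_nonneg)
  moreover have L0: "0 < L"
    using L(1) pos(1) by (meson divide_pos_pos less_le_trans zero_less_one)
  have "(norm (x (k + s) - z))\<^sup>2 \<le> (norm (x k - z))\<^sup>2"
    using fejer_monotoneD[OF fejer z(1), of k "k + s"] by (simp add: power_mono)
  then have "0 \<le> G"
    using L0 by (simp add: G_def)
  ultimately have "(infdist (x k) C)\<^sup>2 \<le> (real s * \<kappa>\<^sup>2 * L) * ((norm (x k - z))\<^sup>2 - (norm (x (k + s) - z))\<^sup>2)"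
    by (simp add: power_mult_distrib G_def mult_ac)
  also have "\<dots> \<le> (real s * \<kappa>\<^sup>2 * L) * ((infdist (x k) C)\<^sup>2 - (infdist (x (k + s)) C)\<^sup>2)"
  proof (rule mult_left_mono)
    have "(infdist (x (k + s)) C)\<^sup>2 \<le> (norm (x (k + s) - z))\<^sup>2"
      using infdist_le[OF z(1), of "x (k + s)"] by (intro power_mono infdist_nonneg) (simp add: dist_norm)
    then show "(norm (x k - z))\<^sup>2 - (norm (x (k + s) - z))\<^sup>2 \<le> (infdist (x k) C)\<^sup>2 - (infdist (x (k + s)) C)\<^sup>2"
      using z(2) by (simp add: dist_norm)
  qed (use L0 in simp)
  finally have "(infdist (x k) C)\<^sup>2 / (real s * \<kappa>\<^sup>2 * L) \<le> (infdist (x k) C)\<^sup>2 - (infdist (x (k + s)) C)\<^sup>2"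
    using L0 \<kappa>(1) s_pos by (subst pos_divide_le_eq) (auto simp: mult_ac)
  then show ?thesis
    by (simp add: left_diff_distrib)
qed

text \<open>
  The smallest admissible \<open>L\<close> in \<open>infdist_decay\<close> is \<open>1 / min \<rho> (\<delta>\<^sup>2 / K)\<close>.  When
  \<open>x 0 \<notin> C\<close> the base of the power is nonnegative, and positive unless \<open>s = 1\<close>; it must not vanish
  for \<open>s > 1\<close>, because the exponent is then negative at the first indices and \<open>0\<close> raised to a
  negative power is \<open>0\<close>.  For \<open>R\<close>-linear convergence, which asks for a positive ratio, the base
  is enlarged to at least \<open>1/2\<close>.
\<close>

theorem linear_convergence:
  assumes \<rho>: "\<rho> \<le> 1" and \<delta>: "0 < \<delta>"
    and lin: "\<And>i. i \<in> I \<Longrightarrow> linearly_regular_over \<delta> (U i) B"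
    and fam: "linearly_regular_family_over \<kappa> I (\<lambda>i. Fix (U i)) B"
  obtains z where "z \<in> C \<inter> B" "x \<longlonglongrightarrow> z"
    "\<And>k. \<delta> / (2 * \<kappa>) * norm (x k - z) \<le> (MAX i\<in>I. norm (U i (x k) - x k))"
    "\<And>k. (MAX i\<in>I. norm (U i (x k) - x k)) \<le> norm (x k - z)"
    "\<And>k. norm (x k - z) \<le> 2 * infdist (x 0) C *
       root (2 * s) (1 - min \<rho> (\<delta>\<^sup>2 / K) / (real s * \<kappa>\<^sup>2)) powi (int k - int s + 1)"
    "R_linear_convergence x z"
proof -
  define d where "d k = infdist (x k) C" for k
  define b where "b = 1 - min \<rho> (\<delta>\<^sup>2 / K) / (real s * \<kappa>\<^sup>2)"
  have d: "0 \<le> d k" "d k \<le> d 0" for k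
    unfolding d_def by (auto intro: infdist_nonneg fejer_infdist_mono[OF fejer C_ne])
  have \<kappa>: "\<kappa> > 0" "\<And>y. y \<in> B \<Longrightarrow> infdist y C \<le> \<kappa> * (MAX i\<in>I. infdist y (Fix (U i)))"
    using fam C by (auto simp: linearly_regular_family_over_def)
  have decay: "(\<forall>k. d k \<le> d 0 * root (2 * s) b powi (int k - int s + 1))
     \<and> (\<exists>q a. 0 < q \<and> q < 1 \<and> 0 \<le> a \<and> (\<forall>k. d k \<le> a * q ^ k))"
  proof (cases "x 0 \<in> C")
    case True
    then have "d k = 0" for k
      using d[of k] by (simp add: d_def)
    then show ?thesis
      by (intro conjI allI exI[of _ "1/2"] exI[of _ 0]) simp_all
  next
    case False
    note const = regularity_constants[OF lin fam False]
    define M where "M = min \<rho> (\<delta>\<^sup>2 / K)"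
    have M: "0 < M" "M \<le> \<rho>" "M \<le> \<delta>\<^sup>2 / K"
      using pos \<delta> by (auto simp: M_def)
    then have L: "1 / \<rho> \<le> 1 / M" "K / \<delta>\<^sup>2 \<le> 1 / M"
      using pos \<delta> by (auto simp: field_simps)
    have step: "(d (k + s))\<^sup>2 \<le> b * (d k)\<^sup>2" for k
      using infdist_decay[OF \<delta> const(1) L lin fam, of k]
      unfolding d_def b_def by (simp add: M_def[symmetric])
    have "1 \<le> \<kappa>\<^sup>2"
      using const(2) by (simp add: one_le_power)
    then have s\<kappa>: "real s \<le> real s * \<kappa>\<^sup>2"
      using s_pos mult_left_mono[of 1 "\<kappa>\<^sup>2" "real s"] by simp
    have ratio: "0 < M / (real s * \<kappa>\<^sup>2)" "M / (real s * \<kappa>\<^sup>2) \<le> 1 / real s"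
      using M(1,2) \<rho> s_pos s\<kappa> \<kappa>(1) by (auto intro!: frac_le)
    have b1: "b < 1"
      using ratio by (simp add: b_def M_def[symmetric])
    have b0: "0 \<le> b"
    proof -
      have "1 / real s \<le> 1" using s_pos by simp
      then show ?thesis using ratio by (simp add: b_def M_def[symmetric])
    qed
    have "b > 0" if "s \<noteq> 1"
    proof -
      have "1 / real s < 1" using s_pos that by simp
      then show ?thesis using ratio by (simp add: b_def M_def[symmetric])
    qed
    then have "d k \<le> d 0 * root (2 * s) b powi (int k - int s + 1)" for k
      using b0 b1 by (intro geometric_decay_root[where d = d, OF s_pos d step]) auto
    moreover
    define q where "q = root (2 * s) (max b (1/2))"
    have q: "0 < q" "q < 1"
      using s_pos b1 by (auto simp: q_def)
    have "(d (k + s))\<^sup>2 \<le> max b (1/2) * (d k)\<^sup>2" for k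
      by (rule order_trans[OF step mult_right_mono]) auto
    then have "d k \<le> d 0 * q powi (int k - int s + 1)" for k
      unfolding q_def using b1 by (intro geometric_decay_root[where d = d, OF s_pos d]) auto
    moreover have "d 0 * q powi (int k - int s + 1) = d 0 * q powi (1 - int s) * q ^ k" for k
    proof -
      have "q powi (int k - int s + 1) = q powi ((1 - int s) + int k)"
        by (simp add: algebra_simps)
      also have "\<dots> = q powi (1 - int s) * q ^ k"
        using q by (subst power_int_add) auto
      finally show ?thesis by simp
    qed
    ultimately show ?thesis
      using q d(1)[of 0] by (intro conjI exI[of _ q] exI[of _ "d 0 * q powi (1 - int s)"]) auto
  qed
  then obtain q a where q: "0 < q" "q < 1" "0 \<le> a" "\<And>k. d k \<le> a * q ^ k"
    by blast
  have "(\<lambda>k. a * q ^ k) \<longlonglongrightarrow> a * 0"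
    using q by (intro tendsto_intros LIMSEQ_power_zero) auto
  then have "(\<lambda>k. a * q ^ k) \<longlonglongrightarrow> 0" by simp
  then have "d \<longlonglongrightarrow> 0"
    using q(4) d(1) by (intro Lim_null_comparison[of d "\<lambda>k. a * q ^ k"]) auto
  then obtain z where z: "z \<in> C \<inter> B" "x \<longlonglongrightarrow> z" "\<And>k. norm (x k - z) \<le> 2 * d k"
    using strong_convergence_from_infdist unfolding d_def by blast
  show thesis
  proof
    show "z \<in> C \<inter> B" "x \<longlonglongrightarrow> z" by (fact z)+
    show "\<delta> / (2 * \<kappa>) * norm (x k - z) \<le> (MAX i\<in>I. norm (U i (x k) - x k))" for k
    proof -
      have "(MAX i\<in>I. infdist (x k) (Fix (U i))) \<in> (\<lambda>i. infdist (x k) (Fix (U i))) ` I"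
        using I by (intro Max_in) auto
      then obtain i where i: "i \<in> I" "(MAX i\<in>I. infdist (x k) (Fix (U i))) = infdist (x k) (Fix (U i))"
        by blast
      have "norm (x k - z) \<le> 2 * \<kappa> * infdist (x k) (Fix (U i))"
        using z(3)[of k] \<kappa>(2)[OF iterate_in_B[of k]] i(2) by (simp add: d_def)
      then have "\<delta> / (2 * \<kappa>) * norm (x k - z) \<le> \<delta> / (2 * \<kappa>) * (2 * \<kappa> * infdist (x k) (Fix (U i)))"
        using \<delta> \<kappa>(1) by (intro mult_left_mono) auto
      also have "\<dots> = \<delta> * infdist (x k) (Fix (U i))"
        using \<kappa>(1) by simp
      also have "\<dots> \<le> norm (U i (x k) - x k)"
        using lin[OF i(1)] iterate_in_B by (simp add: linearly_regular_over_def)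
      also have "\<dots> \<le> (MAX i\<in>I. norm (U i (x k) - x k))"
        using I i(1) by (intro Max_ge) auto
      finally show ?thesis .
    qed
    show "(MAX i\<in>I. norm (U i (x k) - x k)) \<le> norm (x k - z)" for k
      using I z(1) C_in_Fix cutters by (auto intro!: cutter_displacement_le)
    show "norm (x k - z) \<le> 2 * infdist (x 0) C *
       root (2 * s) (1 - min \<rho> (\<delta>\<^sup>2 / K) / (real s * \<kappa>\<^sup>2)) powi (int k - int s + 1)" for k
    proof -
      have "norm (x k - z) \<le> 2 * (d 0 * root (2 * s) b powi (int k - int s + 1))"
        using z(3)[of k] decay by (meson order_trans mult_left_mono zero_le_numeral)
      then show ?thesis by (simp add: d_def b_def)
    qed
    show "R_linear_convergence x z"
      unfolding R_linear_convergence_def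
    proof (intro exI conjI allI)
      show "norm (x k - z) \<le> (2 * a + 1) * q ^ k" for k
        using z(3)[of k] q(4)[of k] zero_less_power[OF q(1), of k] by (simp add: algebra_simps)
    qed (use q in auto)
  qed
qed

end

section \<open>The extrapolated string averaging method\<close>

theorem theorem4p1:
  fixes U :: "nat \<Rightarrow> 'a::{real_inner, banach} \<Rightarrow> 'a"
    and M s m :: nat
    and I :: "nat set"
    and C B :: "'a set"
    and x :: "nat \<Rightarrow> 'a"
    and N m\<^sub>k :: "nat \<Rightarrow> nat"
    and J :: "nat \<Rightarrow> nat \<Rightarrow> nat list"
    and w :: "nat \<Rightarrow> nat \<Rightarrow> real"
    and T :: "nat \<Rightarrow> 'a \<Rightarrow> 'a"
    and \<sigma> \<tau> :: "nat \<Rightarrow> 'a \<Rightarrow> real"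
    and lam \<Theta> :: "nat \<Rightarrow> real"
    and I\<^sub>k :: "nat \<Rightarrow> nat set"
    and \<omega> lam_lo lam_hi r \<rho> :: real
  assumes I: "I = {1..M}"
    and cutter: "\<forall>i\<in>I. cutter (U i)"
    and C: "C = (\<Inter>i\<in>I. Fix (U i))" "C \<noteq> {}"
    and strings: "\<forall>k. \<forall>n\<in>{1..N k}. is_string I (J k n)"
    and weights: "\<forall>k. (\<forall>n\<in>{1..N k}. w k n > 0) \<and> (\<Sum>n=1..N k. w k n) = 1"
    and T: "\<forall>k. T k = string_average U (N k) (w k) (J k)"
    and lam_pos: "\<forall>k. lam k > 0"
    and \<sigma>_ge_1: "\<forall>k z. \<sigma> k z \<ge> 1"
    and step: "\<forall>k. x (Suc k) = x k + (lam k * \<sigma> k (x k)) *\<^sub>R (T k (x k) - x k)"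
    and I\<^sub>k: "\<forall>k. I\<^sub>k k = active_indices (N k) (J k)"
    and m\<^sub>k: "\<forall>k. m\<^sub>k k = max_string_length (N k) (J k)"
    and m: "bdd_above (range m\<^sub>k)" "m = (SUP k. m\<^sub>k k)"
    and \<omega>: "0 < \<omega>" "\<omega> \<le> 1" "\<forall>k. \<forall>n\<in>{1..N k}. \<omega> \<le> w k n \<and> w k n \<le> 1"
    and lam: "0 < lam_lo" "lam_lo \<le> 1" "1 \<le> lam_hi" "lam_hi < 1 + 1 / real m"
             "\<forall>k. lam_lo \<le> lam k \<and> lam k \<le> lam_hi"
    and \<tau>: "\<forall>k. \<tau> k = extrapolation_bound U (N k) (w k) (J k)"
    and \<sigma>: "\<forall>k z. 1 \<le> \<sigma> k z \<and> \<sigma> k z \<le> \<tau> k z"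
    and control: "intermittent_control s I I\<^sub>k"
    and r: "r = infdist (x 0) C"
    and B: "B = cball (metric_projection C (x 0)) r"
    and \<rho>: "\<rho> = 1 / (real m * lam_hi) + (1 - lam_hi) / lam_hi"
    and \<Theta>: "\<forall>k. \<Theta> k = lam k * \<sigma> k (x k) *
               ((1 + real (m\<^sub>k k) - real (m\<^sub>k k) * lam k * (\<sigma> k (x k) / \<tau> k (x k)))
                / (1 + real (m\<^sub>k k) - real (m\<^sub>k k) / \<tau> k (x k)))"
  shows "((\<forall>i\<in>I. weakly_regular_over (U i) B) \<longrightarrow>
            (\<exists>xinf \<in> C \<inter> B. weakly_converges x xinf))
       \<and> ((\<forall>i\<in>I. regular_over (U i) B) \<and> regular_family_over I (\<lambda>i. Fix (U i)) B \<longrightarrow>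
            (\<exists>xinf \<in> C \<inter> B. x \<longlonglongrightarrow> xinf))
       \<and> (\<forall>\<delta>\<^sub>i \<kappa> \<delta>. (\<forall>i\<in>I. linearly_regular_over (\<delta>\<^sub>i i) (U i) B)
            \<and> linearly_regular_family_over \<kappa> I (\<lambda>i. Fix (U i)) B
            \<and> \<delta> = (MIN i\<in>I. \<delta>\<^sub>i i) \<longrightarrow>
            (\<exists>xinf \<in> C \<inter> B. x \<longlonglongrightarrow> xinf
               \<and> (\<forall>k. \<delta> / (2 * \<kappa>) * norm (x k - xinf) \<le> (MAX i\<in>I. norm (U i (x k) - x k))
                    \<and> (MAX i\<in>I. norm (U i (x k) - x k)) \<le> norm (x k - xinf))
               \<and> (\<forall>k. norm (x k - xinf) \<le> 2 * infdist (x 0) C *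
                    root (2 * s) (1 - \<omega> * \<rho> * \<delta>\<^sup>2 / (real s * \<kappa>\<^sup>2) *
                                      min (1 / (\<omega> * \<delta>\<^sup>2)) (INF k. \<Theta> k))
                      powi (int k - int s + 1))
               \<and> R_linear_convergence x xinf))"
proof -
  have mk: "m\<^sub>k k = max_string_length (N k) (J k)" for k
    using m\<^sub>k by blast
  have sub: "active_indices (N k) (J k) \<subseteq> I" for k
    using strings by (force simp: active_indices_def is_string_def)
  have avg: "string_averaging U (N k) (w k) (J k)" for k
  proof
    show "cutter (U i)" if "i \<in> active_indices (N k) (J k)" for i
      using cutter sub that by blast
  qed (use strings weights in \<open>auto simp: is_string_def\<close>)
  have m1: "1 \<le> real (m\<^sub>k k)" "real (m\<^sub>k k) \<le> real m" for k
    using string_averaging.max_pos[OF avg[of k]] cSUP_upper[OF UNIV_I m(1), of k] by (simp_all add: mk m(2))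
  then have m_pos: "1 \<le> real m"
    using order_trans by blast
  have I_ne: "I \<noteq> {}" and I_fin: "finite I"
  proof -
    have "N 0 \<ge> 1"
      using string_averaging.N_pos[OF avg] .
    then have "is_string I (J 0 1)"
      using strings by simp
    then show "I \<noteq> {}"
      by (auto simp: is_string_def)
    show "finite I" by (simp add: I)
  qed

  have \<rho>': "\<rho> = (1 / real m + 1 - lam_hi) / lam_hi"
    using lam(3) m_pos by (simp add: \<rho> field_simps)
  have \<rho>_pos: "\<rho> > 0"
    using lam(3,4) unfolding \<rho>' by (intro divide_pos_pos) auto
  \<comment> \<open>this turns the string length, a factor from the Cauchy-Schwarz inequality, into \<open>1 / \<rho>\<close>\<close>
  have \<rho>_le: "\<rho> \<le> 1 / real m"
  proof -
    have "1 / real m + 1 - lam_hi \<le> 1 / real m * lam_hi"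
      using lam(3) mult_left_mono[OF lam(3), of "1 / real m"] by simp
    then show ?thesis
      using lam(3) unfolding \<rho>' by (subst pos_divide_le_eq) auto
  qed
  have step_size: "lam k * (1 + \<rho>) \<le> 1 + 1 / real (m\<^sub>k k)" for k
  proof -
    have "lam k * (1 + \<rho>) \<le> lam_hi * (1 + \<rho>)"
      using lam(5) \<rho>_pos by (intro mult_right_mono) auto
    also have "\<dots> = 1 + 1 / real m"
      using lam(3) by (simp add: \<rho>' field_simps)
    also have "\<dots> \<le> 1 + 1 / real (m\<^sub>k k)"
      using m1[of k] by (intro add_left_mono frac_le) auto
    finally show ?thesis .
  qed

  define \<theta> where "\<theta> = (INF k. \<Theta> k)"
  \<comment> \<open>a uniform positive lower bound for \<open>\<Theta>\<close>: the numerator is smallest for \<open>\<sigma> = \<tau>\<close>, \<open>lam k = lam_hi\<close> and string length \<open>m\<close>, and the denominator is at most \<open>1 + m\<close>\<close>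
  define t where "t = lam_lo * ((1 - real m * (lam_hi - 1)) / (1 + real m))"
  have "real m * (lam_hi - 1) < 1"
    using lam(4) m_pos by (simp add: field_simps)
  then have t: "0 < t"
    using lam(1) m_pos by (simp add: t_def)
  have \<sigma>\<tau>: "1 \<le> \<sigma> k (x k)" "\<sigma> k (x k) \<le> extrapolation_bound U (N k) (w k) (J k) (x k)" for k
    using \<sigma> \<tau> by simp_all
  have small: "real (m\<^sub>k k) * lam k \<le> real (m\<^sub>k k) * lam_hi" for k
    using lam(5) by (intro mult_left_mono) auto
  have room: "1 - real m * (lam_hi - 1) \<le> 1 + real (m\<^sub>k k) - real (m\<^sub>k k) * lam_hi" for k
    using mult_right_mono[OF m1(2)[of k], of "lam_hi - 1"] lam(3) by (simp add: algebra_simps)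
  have \<Theta>_ge: "t \<le> \<Theta> k" for k
  proof -
    have \<tau>1: "1 \<le> \<tau> k (x k)" and ratio: "\<sigma> k (x k) / \<tau> k (x k) \<le> 1"
      using \<sigma>\<tau>[of k] \<tau> by auto
    have "real (m\<^sub>k k) * lam k * (\<sigma> k (x k) / \<tau> k (x k)) \<le> real (m\<^sub>k k) * lam k * 1"
      using ratio lam_pos by (intro mult_left_mono mult_nonneg_nonneg) (auto simp: less_imp_le)
    then have num: "1 - real m * (lam_hi - 1)
        \<le> 1 + real (m\<^sub>k k) - real (m\<^sub>k k) * lam k * (\<sigma> k (x k) / \<tau> k (x k))"
      using small[of k] room[of k] by linarith
    have "real (m\<^sub>k k) / \<tau> k (x k) \<le> real (m\<^sub>k k)" "0 \<le> real (m\<^sub>k k) / \<tau> k (x k)"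
      using \<tau>1 mult_left_mono[OF \<tau>1, of "real (m\<^sub>k k)"] by (simp_all add: divide_le_eq)
    then have den: "0 < 1 + real (m\<^sub>k k) - real (m\<^sub>k k) / \<tau> k (x k)"
      "1 + real (m\<^sub>k k) - real (m\<^sub>k k) / \<tau> k (x k) \<le> 1 + real m"
      using m1[of k] by linarith+
    have "lam_lo * 1 \<le> lam k * \<sigma> k (x k)"
      using lam(1,5) \<sigma>\<tau>(1)[of k] by (intro mult_mono) (auto intro: order_trans[OF less_imp_le])
    then show ?thesis
      unfolding t_def \<Theta>[rule_format, of k]
      using num den \<open>real m * (lam_hi - 1) < 1\<close> lam(1) by (intro mult_mono frac_le) auto
  qed
  have bdd: "bdd_below (range \<Theta>)"
    using \<Theta>_ge by (rule bdd_belowI2)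
  have \<theta>: "0 < \<theta>" "\<theta> \<le> \<Theta> k" for k
  proof -
    have "t \<le> \<theta>"
      unfolding \<theta>_def by (rule cINF_greatest) (use \<Theta>_ge in auto)
    with t show "0 < \<theta>" by linarith
    show "\<theta> \<le> \<Theta> k"
      unfolding \<theta>_def by (rule cINF_lower[OF bdd UNIV_I])
  qed

  have progress: "\<rho> * (norm (x (Suc k) - x k))\<^sup>2 \<le> (norm (x k - z))\<^sup>2 - (norm (x (Suc k) - z))\<^sup>2"
    "\<Theta> k * (\<Sum>n=1..N k. w k n * string_energy U (J k n) (x k))
       \<le> (norm (x k - z))\<^sup>2 - (norm (x (Suc k) - z))\<^sup>2" if "z \<in> C" for z k
  proof -
    have z: "z \<in> (\<Inter>i\<in>active_indices (N k) (J k). Fix (U i))"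
      using that sub[of k] C by blast
    have "real (m\<^sub>k k) * lam k \<le> real (m\<^sub>k k) + 1"
      using small[of k] room[of k] \<open>real m * (lam_hi - 1) < 1\<close> by linarith
    note est = string_averaging.extrapolated_step[OF avg z \<sigma>\<tau> lam_pos[rule_format] this[unfolded mk]
        step_size[unfolded mk], of "x (Suc k)"]
    show "\<rho> * (norm (x (Suc k) - x k))\<^sup>2 \<le> (norm (x k - z))\<^sup>2 - (norm (x (Suc k) - z))\<^sup>2"
      using est(1) step T by simp
    show "\<Theta> k * (\<Sum>n=1..N k. w k n * string_energy U (J k n) (x k))
       \<le> (norm (x k - z))\<^sup>2 - (norm (x (Suc k) - z))\<^sup>2"
      using est(2) step T by (simp add: \<Theta> \<tau> mk)
  qed

  define K where "K = 1 / (\<rho> * \<omega> * \<theta>)"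
  define c where "c = metric_projection C (x 0)"
  have C_cc: "closed C" "convex C"
    using cutter unfolding C(1)
    by (auto intro: closed_Fix_cutter convex_Fix_cutter convex_INT)
  obtain p where p: "p \<in> C" "dist (x 0) p = infdist (x 0) C"
    using nearest_point_exists[OF C_cc C(2)] by blast
  then have "\<exists>z. z \<in> C \<and> (\<forall>y\<in>C. dist (x 0) z \<le> dist (x 0) y)"
    using infdist_le by metis
  from someI_ex[OF this] have c: "c \<in> C" "\<And>y. y \<in> C \<Longrightarrow> dist (x 0) c \<le> dist (x 0) y"
    by (auto simp: c_def metric_projection_def)

  interpret fejer_sweep U I C B x s I\<^sub>k \<rho> K r c
  proof
    show "x 0 \<in> B"
      using c(2)[OF p(1)] p(2) by (simp add: B r c_def[symmetric] dist_commute)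
    show "0 < K"
      using \<rho>_pos \<omega>(1) \<theta>(1) by (simp add: K_def)
    show "\<exists>u. (\<forall>z\<in>C. norm (u - z) \<le> norm (x k - z)) \<and>
        (\<forall>z\<in>C. (norm (u - x k) + norm (U i u - u))\<^sup>2 \<le> K * ((norm (x k - z))\<^sup>2 - (norm (x (Suc k) - z))\<^sup>2))"
      if "i \<in> I\<^sub>k k" for i k
    proof -
      define F where "F = (\<Sum>n=1..N k. w k n * string_energy U (J k n) (x k))"
      have "i \<in> active_indices (N k) (J k)"
        using that I\<^sub>k by simp
      from string_averaging.step_passes_near_active_index[OF avg this \<omega>(1)] \<omega>(3)
      obtain u where u: "\<omega> * (norm (u - x k) + norm (U i u - u))\<^sup>2 \<le> real (m\<^sub>k k) * F"
        "\<And>z. z \<in> (\<Inter>i\<in>active_indices (N k) (J k). Fix (U i)) \<Longrightarrow> norm (u - z) \<le> norm (x k - z)"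
        unfolding mk F_def by blast
      have F: "0 \<le> F"
        unfolding F_def by (rule string_averaging.energy_nonneg[OF avg])
      have "\<rho> * real (m\<^sub>k k) \<le> 1"
      proof -
        have "\<rho> * real (m\<^sub>k k) \<le> (1 / real m) * real m"
          using \<rho>_le \<rho>_pos m1[of k] by (intro mult_mono) auto
        then show ?thesis using m_pos by simp
      qed
      have "(norm (u - x k) + norm (U i u - u))\<^sup>2 \<le> K * ((norm (x k - z))\<^sup>2 - (norm (x (Suc k) - z))\<^sup>2)"
        if "z \<in> C" for z
      proof -
        have "(\<rho> * \<omega> * \<theta>) * (norm (u - x k) + norm (U i u - u))\<^sup>2
            = \<rho> * \<theta> * (\<omega> * (norm (u - x k) + norm (U i u - u))\<^sup>2)"
          by simp
        also have "\<dots> \<le> \<rho> * \<theta> * (real (m\<^sub>k k) * F)"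
          using u(1) \<rho>_pos \<theta>(1) by (intro mult_left_mono) auto
        also have "\<dots> = (\<rho> * real (m\<^sub>k k)) * (\<theta> * F)"
          by simp
        also have "\<dots> \<le> 1 * (\<Theta> k * F)"
          using \<open>\<rho> * real (m\<^sub>k k) \<le> 1\<close> \<rho>_pos \<theta>(1) \<theta>(2)[of k] F
          by (intro mult_mono) auto
        also have "\<dots> \<le> (norm (x k - z))\<^sup>2 - (norm (x (Suc k) - z))\<^sup>2"
          using progress(2)[OF that, of k] by (simp add: F_def)
        finally show ?thesis
          using \<rho>_pos \<omega>(1) \<theta>(1) by (simp add: K_def field_simps)
      qed
      moreover have "norm (u - z) \<le> norm (x k - z)" if "z \<in> C" for z
        using u(2)[of z] that sub[of k] C(1) by blast
      ultimately show ?thesis by blast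
    qed
  qed (use I_fin I_ne cutter C(1) c(1) B control \<rho>_pos progress(1) in \<open>auto simp: c_def\<close>)

  show ?thesis
  proof (intro conjI impI allI)
    assume "\<forall>i\<in>I. weakly_regular_over (U i) B"
    then show "\<exists>xinf\<in>C \<inter> B. weakly_converges x xinf"
      using weak_convergence by blast
  next
    assume "(\<forall>i\<in>I. regular_over (U i) B) \<and> regular_family_over I (\<lambda>i. Fix (U i)) B"
    then show "\<exists>xinf\<in>C \<inter> B. x \<longlonglongrightarrow> xinf"
      using strong_convergence by blast
  next
    fix \<delta>\<^sub>i :: "nat \<Rightarrow> real" and \<kappa> \<delta> :: real
    assume reg: "(\<forall>i\<in>I. linearly_regular_over (\<delta>\<^sub>i i) (U i) B)
            \<and> linearly_regular_family_over \<kappa> I (\<lambda>i. Fix (U i)) B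
            \<and> \<delta> = (MIN i\<in>I. \<delta>\<^sub>i i)"
    have \<delta>_le: "\<delta> \<le> \<delta>\<^sub>i i" if "i \<in> I" for i
      using reg I_fin that by simp
    have \<delta>_pos: "\<delta> > 0"
      using reg I_fin I_ne by (auto simp: linearly_regular_over_def)
    have lin: "linearly_regular_over \<delta> (U i) B" if i: "i \<in> I" for i
      unfolding linearly_regular_over_def
    proof (intro conjI ballI \<delta>_pos)
      fix y assume "y \<in> B"
      have "\<delta> * infdist y (Fix (U i)) \<le> \<delta>\<^sub>i i * infdist y (Fix (U i))"
        by (intro mult_right_mono \<delta>_le i infdist_nonneg)
      also have "\<dots> \<le> norm (U i y - y)"
        using reg i \<open>y \<in> B\<close> by (simp add: linearly_regular_over_def)
      finally show "\<delta> * infdist y (Fix (U i)) \<le> norm (U i y - y)" .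
    qed
    have fam: "linearly_regular_family_over \<kappa> I (\<lambda>i. Fix (U i)) B"
      using reg by blast
    have "1 / real m \<le> 1"
      using m_pos by simp
    then have \<rho>1: "\<rho> \<le> 1"
      using \<rho>_le by linarith
    have base: "1 - min \<rho> (\<delta>\<^sup>2 / K) / (real s * \<kappa>\<^sup>2)
        = 1 - \<omega> * \<rho> * \<delta>\<^sup>2 / (real s * \<kappa>\<^sup>2) * min (1 / (\<omega> * \<delta>\<^sup>2)) (INF k. \<Theta> k)"
    proof -
      have pos: "0 < \<omega> * \<rho> * \<delta>\<^sup>2"
        using \<omega>(1) \<rho>_pos \<delta>_pos by simp
      have "\<omega> * \<rho> * \<delta>\<^sup>2 * min (1 / (\<omega> * \<delta>\<^sup>2)) \<theta>
          = min (\<omega> * \<rho> * \<delta>\<^sup>2 * (1 / (\<omega> * \<delta>\<^sup>2))) (\<omega> * \<rho> * \<delta>\<^sup>2 * \<theta>)"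
        using pos by (simp only: min_mult_distrib_left less_imp_le if_True)
      also have "\<omega> * \<rho> * \<delta>\<^sup>2 * (1 / (\<omega> * \<delta>\<^sup>2)) = \<rho>"
        using \<omega>(1) \<delta>_pos by simp
      also have "\<omega> * \<rho> * \<delta>\<^sup>2 * \<theta> = \<delta>\<^sup>2 / K"
        by (simp add: K_def)
      finally show ?thesis
        by (simp add: \<theta>_def[symmetric])
    qed
    obtain z where z: "z \<in> C \<inter> B" "x \<longlonglongrightarrow> z"
      "\<And>k. \<delta> / (2 * \<kappa>) * norm (x k - z) \<le> (MAX i\<in>I. norm (U i (x k) - x k))"
      "\<And>k. (MAX i\<in>I. norm (U i (x k) - x k)) \<le> norm (x k - z)"
      "\<And>k. norm (x k - z) \<le> 2 * infdist (x 0) C *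
         root (2 * s) (1 - min \<rho> (\<delta>\<^sup>2 / K) / (real s * \<kappa>\<^sup>2)) powi (int k - int s + 1)"
      "R_linear_convergence x z"
      using linear_convergence[OF \<rho>1 \<delta>_pos lin fam] by blast
    from z show "\<exists>xinf \<in> C \<inter> B. x \<longlonglongrightarrow> xinf
               \<and> (\<forall>k. \<delta> / (2 * \<kappa>) * norm (x k - xinf) \<le> (MAX i\<in>I. norm (U i (x k) - x k))
                    \<and> (MAX i\<in>I. norm (U i (x k) - x k)) \<le> norm (x k - xinf))
               \<and> (\<forall>k. norm (x k - xinf) \<le> 2 * infdist (x 0) C *
                    root (2 * s) (1 - \<omega> * \<rho> * \<delta>\<^sup>2 / (real s * \<kappa>\<^sup>2) *
                                      min (1 / (\<omega> * \<delta>\<^sup>2)) (INF k. \<Theta> k))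
                      powi (int k - int s + 1))
               \<and> R_linear_convergence x xinf"
      unfolding base by (intro bexI[of _ z]) blast+
  qed
qed

end
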